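(* Let $\mathbb{F}$ be a field of characteristic $p>0$. Then $\mathbb{F}$ is locally embeddable into the class of finite fields of characteristic $p$. In particular, $\mathbb{F}$ is locally embeddable into the class $\{\mathbb{M}_d(\mathbb{F}_p) : d\ge 1\}$ of matrix algebras over $\mathbb{F}_p$.
   Context: Let $R$ be a ring with identity and $\mathcal{S}$ a class of rings with identity. $R$ is locally embeddable into $\mathcal{S}$ if for every finite set $F\subset R$ there exist $S\in\mathcal{S}$ and a map $f\colon F\to S$ such that: (1) for all $x,y\in F$, if $x+y\in F$, then $f(x+y)=f(x)+f(y)$; (2) for all $x,y\in F$, if $xy\in F$, then $f(xy)=f(x)f(y)$; (3) $f$ is injective; and $f(1_R)=1_S$ if $1_R\in F$. $\mathbb{F}_p$ is the field with $p$ elements and $\mathbb{M}_d(\mathbb{F}_p)$ the ring of $d\times d$ matrices over it. *)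

theory Defs
  imports "Jordan_Normal_Form.Matrix" "HOL-Number_Theory.Residues" "HOL-Algebra.Weak_Morphisms"
begin

text \<open>Additive and multiplicative compatibility is only required where the result
  lies in the finite set \<open>A\<close> again.\<close>

definition locally_embeddable :: "('a, 'm) ring_scheme \<Rightarrow> ('b, 'n) ring_scheme set \<Rightarrow> bool" where
  "locally_embeddable R C \<longleftrightarrow>
     (\<forall>A. finite A \<and> A \<subseteq> carrier R \<longrightarrow>
       (\<exists>S\<in>C. \<exists>f. f \<in> A \<rightarrow> carrier S \<and>
          (\<forall>x\<in>A. \<forall>y\<in>A. x \<oplus>\<^bsub>R\<^esub> y \<in> A \<longrightarrow> f (x \<oplus>\<^bsub>R\<^esub> y) = f x \<oplus>\<^bsub>S\<^esub> f y) \<and>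
          (\<forall>x\<in>A. \<forall>y\<in>A. x \<otimes>\<^bsub>R\<^esub> y \<in> A \<longrightarrow> f (x \<otimes>\<^bsub>R\<^esub> y) = f x \<otimes>\<^bsub>S\<^esub> f y) \<and>
          inj_on f A \<and>
          (\<one>\<^bsub>R\<^esub> \<in> A \<longrightarrow> f \<one>\<^bsub>R\<^esub> = \<one>\<^bsub>S\<^esub>)))"

definition characteristic :: "('a, 'm) ring_scheme \<Rightarrow> nat" where
  "characteristic R =
     (if \<exists>n>0. [(n::nat)] \<cdot>\<^bsub>R\<^esub> \<one>\<^bsub>R\<^esub> = \<zero>\<^bsub>R\<^esub>
      then LEAST n::nat. n > 0 \<and> [n] \<cdot>\<^bsub>R\<^esub> \<one>\<^bsub>R\<^esub> = \<zero>\<^bsub>R\<^esub> else 0)"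

text \<open>A class of rings has to live over one fixed element type. For finite fields nothing is
  lost by choosing \<open>nat\<close>; see \<open>finite_field_iso_nat\<close> below.\<close>

definition finite_fields :: "nat \<Rightarrow> nat ring set" where
  "finite_fields p = {S. field S \<and> finite (carrier S) \<and> characteristic S = p}"

text \<open>The library's \<open>ring_mat\<close> takes its entries from a type class. This version takes them
  from a ring with a carrier, so that the modulus of the entry field can be a term.\<close>

definition matrix_ring :: "('a, 'm) ring_scheme \<Rightarrow> nat \<Rightarrow> 'a mat ring" where
  "matrix_ring R d =
     \<lparr>carrier = {A \<in> carrier_mat d d. \<forall>i<d. \<forall>j<d. A $$ (i, j) \<in> carrier R},
      monoid.mult = \<lambda>A B. mat d d (\<lambda>(i, j). \<Oplus>\<^bsub>R\<^esub>k\<in>{..<d}. A $$ (i, k) \<otimes>\<^bsub>R\<^esub> B $$ (k, j)),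
      one = mat d d (\<lambda>(i, j). if i = j then \<one>\<^bsub>R\<^esub> else \<zero>\<^bsub>R\<^esub>),
      zero = mat d d (\<lambda>_. \<zero>\<^bsub>R\<^esub>),
      add = \<lambda>A B. mat d d (\<lambda>(i, j). A $$ (i, j) \<oplus>\<^bsub>R\<^esub> B $$ (i, j))\<rparr>"

lemma characteristic_iso:
  assumes "ring R" "ring S" "h \<in> ring_iso R S"
  shows "characteristic S = characteristic R"
proof -
  interpret R: ring R by fact
  interpret S: ring S by fact
  have hom: "h \<in> ring_hom R S" and inj: "inj_on h (carrier R)"
    using assms(3) by (auto simp: ring_iso_def bij_betw_def)
  interpret h: ring_hom_ring R S h
    by (rule ring_hom_ringI2) (use assms hom in auto)
  have pow: "h ([n] \<cdot>\<^bsub>R\<^esub> \<one>\<^bsub>R\<^esub>) = [n] \<cdot>\<^bsub>S\<^esub> \<one>\<^bsub>S\<^esub>" for n :: nat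
    by (induction n) auto
  have eq: "[n] \<cdot>\<^bsub>S\<^esub> \<one>\<^bsub>S\<^esub> = \<zero>\<^bsub>S\<^esub> \<longleftrightarrow> [n] \<cdot>\<^bsub>R\<^esub> \<one>\<^bsub>R\<^esub> = \<zero>\<^bsub>R\<^esub>" for n :: nat
    using inj_onD[OF inj, of "[n] \<cdot>\<^bsub>R\<^esub> \<one>\<^bsub>R\<^esub>" "\<zero>\<^bsub>R\<^esub>"] pow[of n] by auto
  show ?thesis
    unfolding characteristic_def eq by (rule refl)
qed

lemma finite_field_iso_nat:
  fixes K :: "'a ring"
  assumes "field K" "finite (carrier K)"
  shows "\<exists>S\<in>finite_fields (characteristic K). K \<simeq> S"
proof -
  interpret K: field K by fact
  obtain g :: "'a \<Rightarrow> nat" where g: "inj_on g (carrier K)"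
    using assms(2) finite_imp_inj_to_nat_seg by blast
  have iso: "g \<in> ring_iso K (image_ring g K)"
    using inj_imp_image_ring_iso[OF g] .
  have fld: "field (image_ring g K)"
    using K.inj_imp_image_ring_is_field[OF g] .
  have "finite (carrier (image_ring g K))"
    using assms(2) by (simp add: image_ring_carrier)
  moreover have "characteristic (image_ring g K) = characteristic K"
    using characteristic_iso[OF K.ring_axioms _ iso] fld
    by (simp add: field_def domain_def cring_def)
  ultimately have "image_ring g K \<in> finite_fields (characteristic K)"
    using fld by (simp add: finite_fields_def)
  then show ?thesis
    using iso is_ring_iso_def by blast
qed

lemma ring_matrix_ring:
  assumes "ring R"
  shows "ring (matrix_ring R d)"
proof -
  interpret ring R by fact
  have sum_dist: "finsum R (\<lambda>k. f k \<oplus>\<^bsub>R\<^esub> g k) {..<d} = finsum R f {..<d} \<oplus>\<^bsub>R\<^esub> finsum R g {..<d}"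
    if "\<And>k. k < d \<Longrightarrow> f k \<in> carrier R" "\<And>k. k < d \<Longrightarrow> g k \<in> carrier R" for f g
    by (rule finsum_addf) (use that in auto)
  have swap: "(\<Oplus>\<^bsub>R\<^esub>k\<in>{..<d}. \<Oplus>\<^bsub>R\<^esub>l\<in>{..<n}. f k l) = (\<Oplus>\<^bsub>R\<^esub>l\<in>{..<n}. \<Oplus>\<^bsub>R\<^esub>k\<in>{..<d}. f k l)"
    if "\<And>k l. k < d \<Longrightarrow> l < n \<Longrightarrow> f k l \<in> carrier R" for f :: "nat \<Rightarrow> nat \<Rightarrow> 'a" and n
    using that
  proof (induction n)
    case (Suc n)
    have ins: "(\<Oplus>\<^bsub>R\<^esub>l\<in>{..<Suc n}. h l) = h n \<oplus>\<^bsub>R\<^esub> (\<Oplus>\<^bsub>R\<^esub>l\<in>{..<n}. h l)"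
      if "\<And>l. l < Suc n \<Longrightarrow> h l \<in> carrier R" for h
      using that by (simp add: lessThan_Suc Pi_def)
    have "(\<Oplus>\<^bsub>R\<^esub>k\<in>{..<d}. \<Oplus>\<^bsub>R\<^esub>l\<in>{..<Suc n}. f k l)
        = (\<Oplus>\<^bsub>R\<^esub>k\<in>{..<d}. f k n \<oplus>\<^bsub>R\<^esub> (\<Oplus>\<^bsub>R\<^esub>l\<in>{..<n}. f k l))"
      by (rule finsum_cong') (use Suc.prems in \<open>auto simp: ins Pi_def intro!: a_closed finsum_closed\<close>)
    also have "\<dots> = (\<Oplus>\<^bsub>R\<^esub>k\<in>{..<d}. f k n) \<oplus>\<^bsub>R\<^esub> (\<Oplus>\<^bsub>R\<^esub>k\<in>{..<d}. \<Oplus>\<^bsub>R\<^esub>l\<in>{..<n}. f k l)"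
      by (rule sum_dist) (use Suc.prems in \<open>auto intro!: finsum_closed\<close>)
    also have "\<dots> = (\<Oplus>\<^bsub>R\<^esub>l\<in>{..<Suc n}. \<Oplus>\<^bsub>R\<^esub>k\<in>{..<d}. f k l)"
      using Suc by (subst ins) (auto intro!: finsum_closed)
    finally show ?case .
  qed simp
  have delta_l: "(\<Oplus>\<^bsub>R\<^esub>k\<in>{..<d}. (if i = k then \<one>\<^bsub>R\<^esub> else \<zero>\<^bsub>R\<^esub>) \<otimes>\<^bsub>R\<^esub> f k) = f i"
    if "i < d" "\<And>k. k < d \<Longrightarrow> f k \<in> carrier R" for f i
  proof -
    have "(\<Oplus>\<^bsub>R\<^esub>k\<in>{..<d}. (if i = k then \<one>\<^bsub>R\<^esub> else \<zero>\<^bsub>R\<^esub>) \<otimes>\<^bsub>R\<^esub> f k)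
        = (\<Oplus>\<^bsub>R\<^esub>k\<in>{..<d}. if i = k then f k else \<zero>\<^bsub>R\<^esub>)"
      by (rule finsum_cong') (use that in auto)
    then show ?thesis
      using add.finprod_singleton[of i "{..<d}" f] that by auto
  qed
  have delta_r: "(\<Oplus>\<^bsub>R\<^esub>k\<in>{..<d}. f k \<otimes>\<^bsub>R\<^esub> (if k = i then \<one>\<^bsub>R\<^esub> else \<zero>\<^bsub>R\<^esub>)) = f i"
    if "i < d" "\<And>k. k < d \<Longrightarrow> f k \<in> carrier R" for f i
  proof -
    have "(\<Oplus>\<^bsub>R\<^esub>k\<in>{..<d}. f k \<otimes>\<^bsub>R\<^esub> (if k = i then \<one>\<^bsub>R\<^esub> else \<zero>\<^bsub>R\<^esub>))
        = (\<Oplus>\<^bsub>R\<^esub>k\<in>{..<d}. if i = k then f k else \<zero>\<^bsub>R\<^esub>)"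
      by (rule finsum_cong') (use that in auto)
    then show ?thesis
      using add.finprod_singleton[of i "{..<d}" f] that by auto
  qed
  show ?thesis
  proof (rule ringI)
    show "abelian_group (matrix_ring R d)"
    proof (rule abelian_groupI, goal_cases)
      case (6 A)
      then show ?case
        by (intro bexI[of _ "mat d d (\<lambda>(i, j). \<ominus>\<^bsub>R\<^esub> (A $$ (i, j)))"])
          (auto simp: matrix_ring_def l_neg)
    qed (auto simp: matrix_ring_def a_assoc intro!: eq_matI a_comm)
    show "Group.monoid (matrix_ring R d)"
    proof (rule monoidI, goal_cases)
      case (3 A B C)
      then have
        A: "\<And>i j. i < d \<Longrightarrow> j < d \<Longrightarrow> A $$ (i, j) \<in> carrier R" and
        B: "\<And>i j. i < d \<Longrightarrow> j < d \<Longrightarrow> B $$ (i, j) \<in> carrier R" and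
        C: "\<And>i j. i < d \<Longrightarrow> j < d \<Longrightarrow> C $$ (i, j) \<in> carrier R"
        by (auto simp: matrix_ring_def)
      have "(\<Oplus>\<^bsub>R\<^esub>k\<in>{..<d}. (\<Oplus>\<^bsub>R\<^esub>l\<in>{..<d}. A $$ (i, l) \<otimes>\<^bsub>R\<^esub> B $$ (l, k)) \<otimes>\<^bsub>R\<^esub> C $$ (k, j))
          = (\<Oplus>\<^bsub>R\<^esub>l\<in>{..<d}. A $$ (i, l) \<otimes>\<^bsub>R\<^esub> (\<Oplus>\<^bsub>R\<^esub>k\<in>{..<d}. B $$ (l, k) \<otimes>\<^bsub>R\<^esub> C $$ (k, j)))"
        if ij: "i < d" "j < d" for i j
      proof -
        have "(\<Oplus>\<^bsub>R\<^esub>k\<in>{..<d}. (\<Oplus>\<^bsub>R\<^esub>l\<in>{..<d}. A $$ (i, l) \<otimes>\<^bsub>R\<^esub> B $$ (l, k)) \<otimes>\<^bsub>R\<^esub> C $$ (k, j))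
          = (\<Oplus>\<^bsub>R\<^esub>k\<in>{..<d}. \<Oplus>\<^bsub>R\<^esub>l\<in>{..<d}. A $$ (i, l) \<otimes>\<^bsub>R\<^esub> B $$ (l, k) \<otimes>\<^bsub>R\<^esub> C $$ (k, j))"
          by (rule finsum_cong') (use ij A B C in \<open>auto intro!: finsum_ldistr finsum_closed\<close>)
        also have "\<dots> = (\<Oplus>\<^bsub>R\<^esub>l\<in>{..<d}. \<Oplus>\<^bsub>R\<^esub>k\<in>{..<d}. A $$ (i, l) \<otimes>\<^bsub>R\<^esub> B $$ (l, k) \<otimes>\<^bsub>R\<^esub> C $$ (k, j))"
          by (rule swap) (use ij A B C in auto)
        also have "\<dots> = (\<Oplus>\<^bsub>R\<^esub>l\<in>{..<d}. \<Oplus>\<^bsub>R\<^esub>k\<in>{..<d}. A $$ (i, l) \<otimes>\<^bsub>R\<^esub> (B $$ (l, k) \<otimes>\<^bsub>R\<^esub> C $$ (k, j)))"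
          by (intro finsum_cong') (use ij A B C in \<open>auto simp: m_assoc intro!: finsum_closed\<close>)
        also have "\<dots> = (\<Oplus>\<^bsub>R\<^esub>l\<in>{..<d}. A $$ (i, l) \<otimes>\<^bsub>R\<^esub> (\<Oplus>\<^bsub>R\<^esub>k\<in>{..<d}. B $$ (l, k) \<otimes>\<^bsub>R\<^esub> C $$ (k, j)))"
          by (rule finsum_cong') (use ij A B C in \<open>auto intro!: finsum_rdistr[symmetric] finsum_closed\<close>)
        finally show ?thesis .
      qed
      note assoc = this
      have in1: "(\<Oplus>\<^bsub>R\<^esub>k\<in>{..<d}. mat d d (\<lambda>(i, j). F i j) $$ (i, k) \<otimes>\<^bsub>R\<^esub> C $$ (k, j))
          = (\<Oplus>\<^bsub>R\<^esub>k\<in>{..<d}. F i k \<otimes>\<^bsub>R\<^esub> C $$ (k, j))"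
        if "i < d" "j < d" "\<And>i j. i < d \<Longrightarrow> j < d \<Longrightarrow> F i j \<in> carrier R" for i j F
        by (rule finsum_cong') (use that C in auto)
      have in2: "(\<Oplus>\<^bsub>R\<^esub>k\<in>{..<d}. A $$ (i, k) \<otimes>\<^bsub>R\<^esub> mat d d (\<lambda>(i, j). F i j) $$ (k, j))
          = (\<Oplus>\<^bsub>R\<^esub>k\<in>{..<d}. A $$ (i, k) \<otimes>\<^bsub>R\<^esub> F k j)"
        if "i < d" "j < d" "\<And>i j. i < d \<Longrightarrow> j < d \<Longrightarrow> F i j \<in> carrier R" for i j F
        by (rule finsum_cong') (use that A in auto)
      show ?case
        unfolding matrix_ring_def monoid.simps
        by (rule eq_matI) (use A B C assoc in \<open>auto simp: in1 in2 Pi_def intro!: finsum_closed\<close>)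
    next
      case (4 A)
      have "(\<Oplus>\<^bsub>R\<^esub>k\<in>{..<d}. mat d d (\<lambda>(i, j). if i = j then \<one>\<^bsub>R\<^esub> else \<zero>\<^bsub>R\<^esub>) $$ (i, k) \<otimes>\<^bsub>R\<^esub> A $$ (k, j)) = A $$ (i, j)"
        if "i < d" "j < d" for i j
      proof -
        have "(\<Oplus>\<^bsub>R\<^esub>k\<in>{..<d}. mat d d (\<lambda>(i, j). if i = j then \<one>\<^bsub>R\<^esub> else \<zero>\<^bsub>R\<^esub>) $$ (i, k) \<otimes>\<^bsub>R\<^esub> A $$ (k, j))
          = (\<Oplus>\<^bsub>R\<^esub>k\<in>{..<d}. (if i = k then \<one>\<^bsub>R\<^esub> else \<zero>\<^bsub>R\<^esub>) \<otimes>\<^bsub>R\<^esub> A $$ (k, j))"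
          by (rule finsum_cong') (use 4 that in \<open>auto simp: matrix_ring_def\<close>)
        then show ?thesis
          using delta_l[of i "\<lambda>k. A $$ (k, j)"] 4 that by (auto simp: matrix_ring_def)
      qed
      then show ?case
        using 4 by (auto simp: matrix_ring_def intro!: eq_matI)
    next
      case (5 A)
      have "(\<Oplus>\<^bsub>R\<^esub>k\<in>{..<d}. A $$ (i, k) \<otimes>\<^bsub>R\<^esub> mat d d (\<lambda>(i, j). if i = j then \<one>\<^bsub>R\<^esub> else \<zero>\<^bsub>R\<^esub>) $$ (k, j)) = A $$ (i, j)"
        if "i < d" "j < d" for i j
      proof -
        have "(\<Oplus>\<^bsub>R\<^esub>k\<in>{..<d}. A $$ (i, k) \<otimes>\<^bsub>R\<^esub> mat d d (\<lambda>(i, j). if i = j then \<one>\<^bsub>R\<^esub> else \<zero>\<^bsub>R\<^esub>) $$ (k, j))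
          = (\<Oplus>\<^bsub>R\<^esub>k\<in>{..<d}. A $$ (i, k) \<otimes>\<^bsub>R\<^esub> (if k = j then \<one>\<^bsub>R\<^esub> else \<zero>\<^bsub>R\<^esub>))"
          by (rule finsum_cong') (use 5 that in \<open>auto simp: matrix_ring_def\<close>)
        then show ?thesis
          using delta_r[of j "\<lambda>k. A $$ (i, k)"] 5 that by (auto simp: matrix_ring_def)
      qed
      then show ?case
        using 5 by (auto simp: matrix_ring_def intro!: eq_matI)
    qed (auto simp: matrix_ring_def intro!: finsum_closed)
  next
    fix A B C
    assume 1: "A \<in> carrier (matrix_ring R d)" "B \<in> carrier (matrix_ring R d)" "C \<in> carrier (matrix_ring R d)"
    have "(\<Oplus>\<^bsub>R\<^esub>k\<in>{..<d}. mat d d (\<lambda>(i, j). A $$ (i, j) \<oplus>\<^bsub>R\<^esub> B $$ (i, j)) $$ (i, k) \<otimes>\<^bsub>R\<^esub> C $$ (k, j))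
        = (\<Oplus>\<^bsub>R\<^esub>k\<in>{..<d}. A $$ (i, k) \<otimes>\<^bsub>R\<^esub> C $$ (k, j) \<oplus>\<^bsub>R\<^esub> B $$ (i, k) \<otimes>\<^bsub>R\<^esub> C $$ (k, j))"
      if "i < d" "j < d" for i j
      by (rule finsum_cong') (use 1 that in \<open>auto simp: matrix_ring_def l_distr\<close>)
    then show "(A \<oplus>\<^bsub>matrix_ring R d\<^esub> B) \<otimes>\<^bsub>matrix_ring R d\<^esub> C =
        A \<otimes>\<^bsub>matrix_ring R d\<^esub> C \<oplus>\<^bsub>matrix_ring R d\<^esub> B \<otimes>\<^bsub>matrix_ring R d\<^esub> C"
      using 1 by (auto simp: matrix_ring_def sum_dist intro!: eq_matI)
    have "(\<Oplus>\<^bsub>R\<^esub>k\<in>{..<d}. C $$ (i, k) \<otimes>\<^bsub>R\<^esub> mat d d (\<lambda>(i, j). A $$ (i, j) \<oplus>\<^bsub>R\<^esub> B $$ (i, j)) $$ (k, j))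
        = (\<Oplus>\<^bsub>R\<^esub>k\<in>{..<d}. C $$ (i, k) \<otimes>\<^bsub>R\<^esub> A $$ (k, j) \<oplus>\<^bsub>R\<^esub> C $$ (i, k) \<otimes>\<^bsub>R\<^esub> B $$ (k, j))"
      if "i < d" "j < d" for i j
      by (rule finsum_cong') (use 1 that in \<open>auto simp: matrix_ring_def r_distr\<close>)
    then show "C \<otimes>\<^bsub>matrix_ring R d\<^esub> (A \<oplus>\<^bsub>matrix_ring R d\<^esub> B) =
        C \<otimes>\<^bsub>matrix_ring R d\<^esub> A \<oplus>\<^bsub>matrix_ring R d\<^esub> C \<otimes>\<^bsub>matrix_ring R d\<^esub> B"
      using 1 by (auto simp: matrix_ring_def sum_dist intro!: eq_matI)
  qed
qed

end

theory Submission
  imports Defs "HOL-Algebra.Algebraic_Closure"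
begin

text \<open>
  Let \<open>A\<close> be a finite subset of a field \<open>F\<close> of characteristic \<open>p > 0\<close>, and let \<open>L\<close> be an algebraic
  closure of the prime field. The ring generated by \<open>A\<close> is a finitely generated domain over the
  prime field, and such a domain has many homomorphisms to \<open>L\<close>: for every nonzero element \<open>b\<close> there
  is one that does not kill \<open>b\<close>. This form of the Nullstellensatz is proved by adjoining the
  generators one at a time (\<open>points_separate_adjoin\<close>). Taking for \<open>b\<close> a common multiple of the
  differences of distinct elements of \<open>A\<close> gives a homomorphism that is injective on \<open>A\<close>
  (\<open>points_separate_imp_inj_on\<close>). The image of \<open>A\<close> consists of finitely many elements that are
  algebraic over the finite prime field, so it lies in a finite subfield of \<open>L\<close>
  (\<open>finite_set_in_finite_subfield\<close>), and a finite field has a copy on the natural numbers. Altogether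
  this is \<open>locally_embeddable_finite_fields\<close>.

  A finite field \<open>S\<close> of characteristic \<open>p\<close> is a vector space of some finite dimension \<open>d \<ge> 1\<close> over
  its prime field. Each of its elements acts on this space by multiplication, and the matrices of
  these maps embed \<open>S\<close> as a unital ring into the \<open>d \<times> d\<close> matrices
  (\<open>finite_field_embeds_into_matrix_ring\<close>). A local embedding followed by an embedding is again a
  local embedding, which gives the statement about matrix rings.
\<close>

section \<open>Characteristic and prime field\<close>

lemma (in ring) nat_multiple_one_mod:
  assumes "[(p::nat)] \<cdot> \<one> = \<zero>"
  shows "[(n mod p)] \<cdot> \<one> = [n] \<cdot> \<one>"
proof -
  have "[(p * k)] \<cdot> \<one> = \<zero>" for k :: nat
    using add.nat_pow_pow[of "\<one>" k p] assms by simp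
  then have "[(p * (n div p))] \<cdot> \<one> \<oplus> [(n mod p)] \<cdot> \<one> = [(n mod p)] \<cdot> \<one>"
    by simp
  then show ?thesis
    by (simp add: add.nat_pow_mult)
qed

lemma characteristic_dvd_iff:
  assumes "ring R" and "characteristic R > 0"
  shows "[n] \<cdot>\<^bsub>R\<^esub> \<one>\<^bsub>R\<^esub> = \<zero>\<^bsub>R\<^esub> \<longleftrightarrow> characteristic R dvd n"
proof -
  interpret ring R by fact
  define p where "p = characteristic R"
  have ex: "\<exists>n>0. [(n::nat)] \<cdot>\<^bsub>R\<^esub> \<one>\<^bsub>R\<^esub> = \<zero>\<^bsub>R\<^esub>"
    using assms(2) by (auto simp: characteristic_def split: if_splits)
  then have p_least: "p = (LEAST n. n > 0 \<and> [n] \<cdot>\<^bsub>R\<^esub> \<one>\<^bsub>R\<^esub> = \<zero>\<^bsub>R\<^esub>)"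
    by (simp add: p_def characteristic_def)
  have p: "p > 0" "[p] \<cdot>\<^bsub>R\<^esub> \<one>\<^bsub>R\<^esub> = \<zero>\<^bsub>R\<^esub>"
    using LeastI_ex[OF ex] by (auto simp: p_least)
  have mod: "[n] \<cdot>\<^bsub>R\<^esub> \<one>\<^bsub>R\<^esub> = [(n mod p)] \<cdot>\<^bsub>R\<^esub> \<one>\<^bsub>R\<^esub>"
    using nat_multiple_one_mod[OF p(2)] by simp
  have zero: "n mod p = 0" if "[(n mod p)] \<cdot>\<^bsub>R\<^esub> \<one>\<^bsub>R\<^esub> = \<zero>\<^bsub>R\<^esub>"
    using that not_less_Least[of "n mod p" "\<lambda>n. n > 0 \<and> [n] \<cdot>\<^bsub>R\<^esub> \<one>\<^bsub>R\<^esub> = \<zero>\<^bsub>R\<^esub>"] p(1)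
    by (auto simp: p_least[symmetric])
  have "[(n mod p)] \<cdot>\<^bsub>R\<^esub> \<one>\<^bsub>R\<^esub> = \<zero>\<^bsub>R\<^esub> \<longleftrightarrow> n mod p = 0"
    using zero by (cases "n mod p = 0") auto
  then show ?thesis
    unfolding p_def[symmetric] mod dvd_eq_mod_eq_0 .
qed

lemma ring_hom_nat_multiple_one:
  assumes "ring A" "ring B" "h \<in> ring_hom A B"
  shows "h ([(n::nat)] \<cdot>\<^bsub>A\<^esub> \<one>\<^bsub>A\<^esub>) = [n] \<cdot>\<^bsub>B\<^esub> \<one>\<^bsub>B\<^esub>"
proof -
  interpret h: ring_hom_ring A B h
    using assms by (rule ring_hom_ringI2)
  show ?thesis
    by (induction n) auto
qed

lemma (in domain) prime_characteristic:
  assumes "characteristic R > 0"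
  shows "Factorial_Ring.prime (characteristic R)"
proof (rule prime_nat_iff[THEN iffD2], safe)
  define p where "p = characteristic R"
  note dvd_iff = characteristic_dvd_iff[OF ring_axioms assms, folded p_def]
  have "\<not> p dvd 1"
    using dvd_iff[of 1] by simp
  then show "1 < characteristic R"
    using assms by (cases "p = 1") (auto simp: p_def)
  fix m assume "m dvd characteristic R" "m \<noteq> characteristic R"
  then obtain n where n: "p = m * n"
    by (auto simp: p_def dvd_def)
  have "([m] \<cdot> \<one>) \<otimes> ([n] \<cdot> \<one>) = [p] \<cdot> \<one>"
    by (simp add: add_pow_ldistr add_pow_rdistr add.nat_pow_pow n mult.commute)
  also have "\<dots> = \<zero>"
    using dvd_iff[of p] by simp
  finally have "[m] \<cdot> \<one> = \<zero> \<or> [n] \<cdot> \<one> = \<zero>"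
    by (rule integral) simp_all
  then have "p dvd m \<or> p dvd n"
    by (simp add: dvd_iff)
  then show "m = 1"
    using n assms \<open>m \<noteq> characteristic R\<close> by (auto simp: p_def[symmetric] dest: dvd_antisym)
qed

text \<open>
  This is the canonical map onto the prime ring. Elements of the residue ring are integers in
  \<open>{0..<p}\<close>, so \<open>nat\<close> does not truncate.
\<close>
lemma residue_ring_hom:
  assumes "ring R" and "characteristic R > 1"
  shows "(\<lambda>i. [(nat i)] \<cdot>\<^bsub>R\<^esub> \<one>\<^bsub>R\<^esub>) \<in> ring_hom (residue_ring (int (characteristic R))) R"
proof -
  interpret ring R by fact
  define p where "p = characteristic R"
  note dvd_iff = characteristic_dvd_iff[OF assms(1), folded p_def]
  have mod: "[(n mod p)] \<cdot>\<^bsub>R\<^esub> \<one>\<^bsub>R\<^esub> = [n] \<cdot>\<^bsub>R\<^esub> \<one>\<^bsub>R\<^esub>" for n :: nat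
    by (rule nat_multiple_one_mod) (use dvd_iff[of p] assms(2) in \<open>simp add: p_def\<close>)
  show ?thesis
    unfolding p_def[symmetric]
  proof (rule ring_hom_memI)
    fix x y assume "x \<in> carrier (residue_ring (int p))" "y \<in> carrier (residue_ring (int p))"
    then have xy: "x \<ge> 0" "y \<ge> 0"
      by (auto simp: residue_ring_def)
    then have *: "nat ((x * y) mod int p) = (nat x * nat y) mod p"
      "nat ((x + y) mod int p) = (nat x + nat y) mod p"
      by (simp_all add: nat_mod_distrib nat_mult_distrib nat_add_distrib)
    show "[(nat (x \<otimes>\<^bsub>residue_ring (int p)\<^esub> y))] \<cdot>\<^bsub>R\<^esub> \<one>\<^bsub>R\<^esub> =
      ([(nat x)] \<cdot>\<^bsub>R\<^esub> \<one>\<^bsub>R\<^esub>) \<otimes>\<^bsub>R\<^esub> ([(nat y)] \<cdot>\<^bsub>R\<^esub> \<one>\<^bsub>R\<^esub>)"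
      by (simp add: residue_ring_def * mod add_pow_ldistr add_pow_rdistr add.nat_pow_pow mult.commute)
    show "[(nat (x \<oplus>\<^bsub>residue_ring (int p)\<^esub> y))] \<cdot>\<^bsub>R\<^esub> \<one>\<^bsub>R\<^esub> =
      ([(nat x)] \<cdot>\<^bsub>R\<^esub> \<one>\<^bsub>R\<^esub>) \<oplus>\<^bsub>R\<^esub> ([(nat y)] \<cdot>\<^bsub>R\<^esub> \<one>\<^bsub>R\<^esub>)"
      by (simp add: residue_ring_def * mod add.nat_pow_mult)
  qed (auto simp: residue_ring_def)
qed

lemma residue_ring_hom_inj:
  assumes "ring R" and "characteristic R > 0"
  shows "inj_on (\<lambda>i. [(nat i)] \<cdot>\<^bsub>R\<^esub> \<one>\<^bsub>R\<^esub>) (carrier (residue_ring (int (characteristic R))))"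
proof -
  interpret ring R by fact
  define p where "p = characteristic R"
  have less: "m = n" if mn: "m \<le> n" "n < p" and eq: "[m] \<cdot>\<^bsub>R\<^esub> \<one>\<^bsub>R\<^esub> = [n] \<cdot>\<^bsub>R\<^esub> \<one>\<^bsub>R\<^esub>" for m n :: nat
  proof -
    have "[m] \<cdot>\<^bsub>R\<^esub> \<one>\<^bsub>R\<^esub> \<oplus>\<^bsub>R\<^esub> [(n - m)] \<cdot>\<^bsub>R\<^esub> \<one>\<^bsub>R\<^esub> = [(m + (n - m))] \<cdot>\<^bsub>R\<^esub> \<one>\<^bsub>R\<^esub>"
      by (simp only: add.nat_pow_mult one_closed)
    also have "\<dots> = [m] \<cdot>\<^bsub>R\<^esub> \<one>\<^bsub>R\<^esub>"
      using mn(1) eq by (simp only: le_add_diff_inverse)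
    finally have "[(n - m)] \<cdot>\<^bsub>R\<^esub> \<one>\<^bsub>R\<^esub> = \<zero>\<^bsub>R\<^esub>"
      by simp
    then have "p dvd n - m"
      unfolding characteristic_dvd_iff[OF assms] p_def .
    then have "n - m = 0"
      using nat_dvd_not_less[of "n - m" p] mn(2) by (cases "n - m = 0") simp_all
    then show ?thesis
      using mn by simp
  qed
  show ?thesis
  proof (rule inj_onI)
    fix x y
    assume "x \<in> carrier (residue_ring (int (characteristic R)))"
      "y \<in> carrier (residue_ring (int (characteristic R)))"
      and eq: "[(nat x)] \<cdot>\<^bsub>R\<^esub> \<one>\<^bsub>R\<^esub> = [(nat y)] \<cdot>\<^bsub>R\<^esub> \<one>\<^bsub>R\<^esub>"
    then have xy: "0 \<le> x" "nat x < p" "0 \<le> y" "nat y < p"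
      by (auto simp: residue_ring_def p_def)
    then have "nat x = nat y"
      using less[of "nat x" "nat y"] less[of "nat y" "nat x"] eq by (cases "nat x \<le> nat y") auto
    then show "x = y"
      using xy by simp
  qed
qed

lemma characteristic_inj_hom:
  assumes "ring A" "ring B" "h \<in> ring_hom A B" and inj: "inj_on h (carrier A)"
  shows "characteristic B = characteristic A"
proof -
  interpret h: ring_hom_ring A B h
    using assms(1-3) by (rule ring_hom_ringI2)
  have eq: "[n] \<cdot>\<^bsub>B\<^esub> \<one>\<^bsub>B\<^esub> = \<zero>\<^bsub>B\<^esub> \<longleftrightarrow> [n] \<cdot>\<^bsub>A\<^esub> \<one>\<^bsub>A\<^esub> = \<zero>\<^bsub>A\<^esub>" for n :: nat
    using inj_onD[OF inj, of "[n] \<cdot>\<^bsub>A\<^esub> \<one>\<^bsub>A\<^esub>" "\<zero>\<^bsub>A\<^esub>"]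
      ring_hom_nat_multiple_one[OF assms(1-3), of n] by auto
  show ?thesis
    unfolding characteristic_def eq by (rule refl)
qed

section \<open>Homomorphisms into an algebraically closed field\<close>

text \<open>
  First isomorphism theorem, with the image of \<open>e\<close> as a subring in place of the quotient by the
  kernel. Homomorphisms out of a ring generated by one element over another ring are obtained from
  it, with \<open>P\<close> a polynomial ring.
\<close>
lemma hom_factors_through_image:
  assumes P: "ring P" and B: "ring B" and L: "ring L"
    and e: "e \<in> ring_hom P B" and g: "g \<in> ring_hom P L"
    and ker: "\<And>p. p \<in> carrier P \<Longrightarrow> e p = \<zero>\<^bsub>B\<^esub> \<Longrightarrow> g p = \<zero>\<^bsub>L\<^esub>"
  obtains \<psi> where "\<psi> \<in> ring_hom (B\<lparr>carrier := e ` carrier P\<rparr>) L"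
    and "\<And>p. p \<in> carrier P \<Longrightarrow> \<psi> (e p) = g p"
proof
  interpret e: ring_hom_ring P B e
    using P B e by (rule ring_hom_ringI2)
  interpret g: ring_hom_ring P L g
    using P L g by (rule ring_hom_ringI2)
  define \<psi> where "\<psi> = (\<lambda>y. g (SOME p. p \<in> carrier P \<and> e p = y))"
  show eq: "\<psi> (e p) = g p" if p: "p \<in> carrier P" for p
  proof -
    define q where "q = (SOME q. q \<in> carrier P \<and> e q = e p)"
    have q: "q \<in> carrier P" "e q = e p"
      using someI[of "\<lambda>q. q \<in> carrier P \<and> e q = e p" p] p by (auto simp: q_def)
    have "e (q \<ominus>\<^bsub>P\<^esub> p) = \<zero>\<^bsub>B\<^esub>"
      using p q by (simp add: a_minus_def e.S.r_neg)
    then have "g q \<ominus>\<^bsub>L\<^esub> g p = \<zero>\<^bsub>L\<^esub>"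
      using ker[of "q \<ominus>\<^bsub>P\<^esub> p"] p q by (simp add: a_minus_def)
    then have "g q = g p"
      using p q g.S.r_right_minus_eq by simp
    then show ?thesis
      by (simp add: \<psi>_def q_def)
  qed
  show "\<psi> \<in> ring_hom (B\<lparr>carrier := e ` carrier P\<rparr>) L"
  proof (rule ring_hom_memI)
    fix x y
    assume "x \<in> carrier (B\<lparr>carrier := e ` carrier P\<rparr>)" "y \<in> carrier (B\<lparr>carrier := e ` carrier P\<rparr>)"
    then obtain p q where pq: "p \<in> carrier P" "x = e p" "q \<in> carrier P" "y = e q"
      by auto
    show "\<psi> (x \<otimes>\<^bsub>B\<lparr>carrier := e ` carrier P\<rparr>\<^esub> y) = \<psi> x \<otimes>\<^bsub>L\<^esub> \<psi> y"
      using pq eq[of "p \<otimes>\<^bsub>P\<^esub> q"] by (simp add: eq)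
    show "\<psi> (x \<oplus>\<^bsub>B\<lparr>carrier := e ` carrier P\<rparr>\<^esub> y) = \<psi> x \<oplus>\<^bsub>L\<^esub> \<psi> y"
      using pq eq[of "p \<oplus>\<^bsub>P\<^esub> q"] by (simp add: eq)
  next
    show "\<psi> \<one>\<^bsub>B\<lparr>carrier := e ` carrier P\<rparr>\<^esub> = \<one>\<^bsub>L\<^esub>"
      using eq[of "\<one>\<^bsub>P\<^esub>"] by simp
  qed (auto simp: eq)
qed

text \<open>
  Algebraically closed fields are described by coefficient lists, with the highest coefficient first,
  while pseudo-division and evaluation along a ring homomorphism concern polynomials as coefficient
  functions. This formula links the two evaluations.
\<close>
lemma (in ring) eval_coeff_list:
  assumes "\<And>i. c i \<in> carrier R" and "\<alpha> \<in> carrier R"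
  shows "eval (map c (rev [0..<n])) \<alpha> = (\<Oplus>i\<in>{..<n}. c i \<otimes> \<alpha> [^] i)"
  using assms by (induction n) (simp_all add: lessThan_Suc)

lemma (in algebraically_closed) ex_root_of_mapped_poly:
  assumes A: "cring A" and \<phi>: "\<phi> \<in> ring_hom A L"
    and f: "f \<in> carrier (UP A)" and deg: "deg A f > 0"
    and lc: "\<phi> (UnivPoly.coeff (UP A) f (deg A f)) \<noteq> \<zero>"
  shows "\<exists>\<alpha>\<in>carrier L. UnivPoly.eval A L \<phi> \<alpha> f = \<zero>"
proof -
  interpret U: UP_pre_univ_prop A L \<phi> "UP A"
    using UP_pre_univ_propI[OF A is_cring \<phi>] .
  define c where "c = (\<lambda>i. \<phi> (UnivPoly.coeff (UP A) f i))"
  define p where "p = map c (rev [0..<Suc (deg A f)])"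
  have c: "c i \<in> carrier L" for i
    using f by (simp add: c_def)
  have p: "p \<in> carrier (poly_ring L)"
    using c lc by (auto simp: p_def univ_poly_carrier[symmetric] polynomial_def c_def[symmetric])
      (auto simp: c_def)
  have "splitted p" "degree p > 0"
    using roots_over_carrier[OF p] deg by (auto simp: p_def)
  then obtain \<alpha> where "\<alpha> \<in># roots p"
    unfolding splitted_def by (metis multiset_nonemptyE nonempty_has_size)
  then have \<alpha>: "\<alpha> \<in> carrier L" "eval p \<alpha> = \<zero>"
    using roots_mem_iff_is_root[OF p] by (auto simp: is_root_def)
  have "UnivPoly.eval A L \<phi> \<alpha> f = (\<Oplus>i\<in>{..<Suc (deg A f)}. c i \<otimes> \<alpha> [^] i)"
    using f by (simp add: U.eval_on_carrier c_def lessThan_Suc_atMost)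
  also have "\<dots> = \<zero>"
    using \<alpha> by (subst eval_coeff_list[symmetric]) (auto simp: c p_def)
  finally show ?thesis
    using \<alpha> by blast
qed

text \<open>
  This says that the \<open>L\<close>-valued points of \<open>A\<close>, that is, its homomorphisms to \<open>L\<close>, detect nonzero
  elements. Demanding it for every nonzero element, instead of asking for a single homomorphism, is
  what makes an induction on the number of generators possible: a homomorphism extends to the next
  generator once it does not kill certain leading coefficients and constants.
\<close>
definition points_separate :: "('a, 'm) ring_scheme \<Rightarrow> ('b, 'n) ring_scheme \<Rightarrow> bool" where
  "points_separate A L \<longleftrightarrow>
     (\<forall>b\<in>carrier A. b \<noteq> \<zero>\<^bsub>A\<^esub> \<longrightarrow> (\<exists>\<phi>\<in>ring_hom A L. \<phi> b \<noteq> \<zero>\<^bsub>L\<^esub>))"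

text \<open>
  Write \<open>A[x]\<close> for the image of the evaluation \<open>ev\<close> at \<open>x\<close>, and let \<open>b = ev g\<close> be nonzero.

  If \<open>x\<close> is transcendental over \<open>A\<close>, any value \<open>\<alpha>\<close> may be prescribed for \<open>x\<close>. A homomorphism \<open>\<phi>\<close> that
  does not kill the leading coefficient of \<open>g\<close> leaves a polynomial of the same degree over \<open>L\<close>. If
  the degree is positive, then that polynomial takes the value \<open>1\<close>, because \<open>L\<close> is algebraically
  closed; otherwise it is a nonzero constant.

  If \<open>x\<close> is algebraic, let \<open>f\<close> be a nonzero polynomial of minimal degree with root \<open>x\<close> and leading
  coefficient \<open>a\<close>. By pseudo-division, every polynomial with root \<open>x\<close> becomes a multiple of \<open>f\<close>
  after multiplication by a power of \<open>a\<close>. Hence any root of the image of \<open>f\<close> under \<open>\<phi>\<close> may be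
  prescribed for \<open>x\<close> once \<open>\<phi> a\<close> is nonzero. Over the fraction field \<open>f\<close> is irreducible and does not
  divide \<open>g\<close>, so the ideal \<open>(g, f)\<close> contains a nonzero constant \<open>m\<close>. If \<open>\<phi> m\<close> is nonzero as well, the
  images of \<open>f\<close> and \<open>g\<close> have no common root, and the value of \<open>g\<close> at the chosen root is nonzero.
\<close>
lemma points_separate_adjoin:
  fixes A :: "('a, 'm) ring_scheme" and B :: "('b, 'k) ring_scheme" and L :: "('c, 'n) ring_scheme"
  assumes A: "domain A" and B: "domain B" and L: "algebraically_closed L"
    and h: "h \<in> ring_hom A B" and inj: "inj_on h (carrier A)"
    and x: "x \<in> carrier B" and sep: "points_separate A L"
  shows "points_separate (B\<lparr>carrier := UnivPoly.eval A B h x ` carrier (UP A)\<rparr>) L"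
proof -
  interpret A: domain A by fact
  interpret B: domain B by fact
  interpret L: algebraically_closed L by fact
  define P where "P = UP A"
  interpret UP_domain A P
    by unfold_locales (simp add: P_def)
  interpret U: UP_pre_univ_prop A B h P
    unfolding P_def using UP_pre_univ_propI[OF A.is_cring B.is_cring h] .
  define ev where "ev = UnivPoly.eval A B h x"
  have ev_hom: "ev \<in> ring_hom P B"
    unfolding ev_def using U.eval_ring_hom[OF x] .
  interpret ev: ring_hom_ring P B ev
    using P.ring_axioms B.ring_axioms ev_hom by (rule ring_hom_ringI2)
  have ev_const: "ev (UnivPoly.monom P a 0) = h a" if "a \<in> carrier A" for a
    unfolding ev_def using that x by (simp add: U.eval_const)
  have h_nz: "h a \<noteq> \<zero>\<^bsub>B\<^esub>" if "a \<in> carrier A" "a \<noteq> \<zero>\<^bsub>A\<^esub>" for a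
    using that inj_onD[OF inj, of a "\<zero>\<^bsub>A\<^esub>"] by auto

  have extend: "\<exists>\<psi>\<in>ring_hom (B\<lparr>carrier := ev ` carrier P\<rparr>) L. \<psi> (ev g) \<noteq> \<zero>\<^bsub>L\<^esub>"
    if \<phi>: "\<phi> \<in> ring_hom A L" and \<alpha>: "\<alpha> \<in> carrier L" and g: "g \<in> carrier P"
      and ker: "\<And>p. p \<in> carrier P \<Longrightarrow> ev p = \<zero>\<^bsub>B\<^esub> \<Longrightarrow> UnivPoly.eval A L \<phi> \<alpha> p = \<zero>\<^bsub>L\<^esub>"
      and nz: "UnivPoly.eval A L \<phi> \<alpha> g \<noteq> \<zero>\<^bsub>L\<^esub>" for \<phi> \<alpha> g
  proof -
    interpret V: UP_pre_univ_prop A L \<phi> P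
      unfolding P_def using UP_pre_univ_propI[OF A.is_cring L.is_cring \<phi>] .
    obtain \<psi> where "\<psi> \<in> ring_hom (B\<lparr>carrier := ev ` carrier P\<rparr>) L"
      "\<And>p. p \<in> carrier P \<Longrightarrow> \<psi> (ev p) = UnivPoly.eval A L \<phi> \<alpha> p"
      using hom_factors_through_image[OF P.ring_axioms B.ring_axioms L.ring_axioms ev_hom
          V.eval_ring_hom[OF \<alpha>] ker] by blast
    then show ?thesis
      using g nz by (intro bexI[of _ \<psi>]) auto
  qed

  have main: "\<exists>\<psi>\<in>ring_hom (B\<lparr>carrier := ev ` carrier P\<rparr>) L. \<psi> (ev g) \<noteq> \<zero>\<^bsub>L\<^esub>"
    if g: "g \<in> carrier P" and b: "ev g \<noteq> \<zero>\<^bsub>B\<^esub>" for g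
  proof (cases "\<exists>f\<in>carrier P. f \<noteq> \<zero>\<^bsub>P\<^esub> \<and> ev f = \<zero>\<^bsub>B\<^esub>")
    case transcendental: False
    have g0: "g \<noteq> \<zero>\<^bsub>P\<^esub>"
      using b by auto
    define c where "c = UnivPoly.coeff P g (deg A g)"
    have c: "c \<in> carrier A" "c \<noteq> \<zero>\<^bsub>A\<^esub>"
      using g g0 lcoeff_nonzero2 by (auto simp: c_def)
    then obtain \<phi> where \<phi>: "\<phi> \<in> ring_hom A L" "\<phi> c \<noteq> \<zero>\<^bsub>L\<^esub>"
      using sep by (auto simp: points_separate_def)
    interpret V: UP_pre_univ_prop A L \<phi> P
      unfolding P_def using UP_pre_univ_propI[OF A.is_cring L.is_cring \<phi>(1)] .
    have "\<exists>\<alpha>\<in>carrier L. UnivPoly.eval A L \<phi> \<alpha> g \<noteq> \<zero>\<^bsub>L\<^esub>"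
    proof (cases "deg A g = 0")
      case True
      then have "g = UnivPoly.monom P c 0"
        using deg_zero_impl_monom[OF g] by (simp add: c_def)
      then show ?thesis
        using \<phi> c by (intro bexI[of _ "\<zero>\<^bsub>L\<^esub>"]) (auto simp: V.eval_const)
    next
      case False
      \<comment> \<open>At a root of \<open>g - 1\<close> the value of \<open>g\<close> is \<open>1\<close>, so the roots of \<open>g\<close> need not be counted.\<close>
      define g1 where "g1 = g \<ominus>\<^bsub>P\<^esub> \<one>\<^bsub>P\<^esub>"
      have g1: "g1 \<in> carrier P"
        using g by (simp add: g1_def)
      have co: "UnivPoly.coeff P g1 n = UnivPoly.coeff P g n" if "n > 0" for n
        using that g by (simp add: g1_def A.minus_eq)
      have deg: "deg A g1 = deg A g"
      proof (rule antisym)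
        show "deg A g1 \<le> deg A g"
          using g1 False co g by (intro deg_aboveI) (auto intro!: deg_aboveD)
        show "deg A g \<le> deg A g1"
          using g1 False c co[of "deg A g"] by (intro deg_belowI) (auto simp: c_def)
      qed
      have "UnivPoly.coeff P g1 (deg A g1) = c"
        using co[of "deg A g"] deg False by (simp add: c_def)
      then obtain \<alpha> where \<alpha>: "\<alpha> \<in> carrier L" "UnivPoly.eval A L \<phi> \<alpha> g1 = \<zero>\<^bsub>L\<^esub>"
        using L.ex_root_of_mapped_poly[OF A.is_cring \<phi>(1), of g1] g1 deg False \<phi>(2)
        by (auto simp: P_def)
      interpret W: ring_hom_ring P L "UnivPoly.eval A L \<phi> \<alpha>"
        using P.ring_axioms L.ring_axioms V.eval_ring_hom[OF \<alpha>(1)] by (rule ring_hom_ringI2)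
      have "UnivPoly.eval A L \<phi> \<alpha> g \<ominus>\<^bsub>L\<^esub> \<one>\<^bsub>L\<^esub> = \<zero>\<^bsub>L\<^esub>"
        using \<alpha>(2) g by (simp add: g1_def a_minus_def)
      then have "UnivPoly.eval A L \<phi> \<alpha> g = \<one>\<^bsub>L\<^esub>"
        using g by simp
      then show ?thesis
        using \<alpha>(1) by (intro bexI[of _ \<alpha>]) simp_all
    qed
    then obtain \<alpha> where \<alpha>: "\<alpha> \<in> carrier L" "UnivPoly.eval A L \<phi> \<alpha> g \<noteq> \<zero>\<^bsub>L\<^esub>"
      by blast
    interpret W: ring_hom_ring P L "UnivPoly.eval A L \<phi> \<alpha>"
      using P.ring_axioms L.ring_axioms V.eval_ring_hom[OF \<alpha>(1)] by (rule ring_hom_ringI2)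
    show ?thesis
      by (rule extend[OF \<phi>(1) \<alpha>(1) g _ \<alpha>(2)]) (use transcendental W.hom_zero in auto)
  next
    case algebraic: True
    then obtain f where f: "f \<in> carrier P" "f \<noteq> \<zero>\<^bsub>P\<^esub>" "ev f = \<zero>\<^bsub>B\<^esub>"
      and f_least: "\<forall>q. q \<in> carrier P \<and> q \<noteq> \<zero>\<^bsub>P\<^esub> \<and> ev q = \<zero>\<^bsub>B\<^esub> \<longrightarrow> deg A f \<le> deg A q"
      using ex_has_least_nat[of "\<lambda>f. f \<in> carrier P \<and> f \<noteq> \<zero>\<^bsub>P\<^esub> \<and> ev f = \<zero>\<^bsub>B\<^esub>" _ "deg A"]
      by metis
    have f_min: "deg A f \<le> deg A q"
      if "q \<in> carrier P" "q \<noteq> \<zero>\<^bsub>P\<^esub>" "ev q = \<zero>\<^bsub>B\<^esub>" for q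
      using that f_least by simp
    define a where "a = UnivPoly.coeff P f (deg A f)"
    have a: "a \<in> carrier A" "a \<noteq> \<zero>\<^bsub>A\<^esub>"
      using f lcoeff_nonzero2 by (auto simp: a_def)
    have deg_f: "deg A f > 0"
    proof (rule ccontr)
      assume "\<not> deg A f > 0"
      then have "f = UnivPoly.monom P a 0"
        using deg_zero_impl_monom[OF f(1)] by (simp add: a_def)
      then show False
        using f(3) ev_const h_nz a by auto
    qed
    \<comment> \<open>An element \<open>d\<close> of minimal degree in the ideal \<open>(g, f)\<close> pseudo-divides both \<open>g\<close> and \<open>f\<close>; this is a
      gcd argument that avoids the fraction field.\<close>
    define J where "J = (PIdl\<^bsub>P\<^esub> g) <+>\<^bsub>P\<^esub> (PIdl\<^bsub>P\<^esub> f)"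
    have J: "ideal J P"
      unfolding J_def using P.add_ideals P.cgenideal_ideal g f(1) by blast
    have zero_PIdl: "\<zero>\<^bsub>P\<^esub> \<in> PIdl\<^bsub>P\<^esub> p" if "p \<in> carrier P" for p
      using additive_subgroup.zero_closed[OF ideal.axioms(1)[OF P.cgenideal_ideal[OF that]]] .
    have "g \<oplus>\<^bsub>P\<^esub> \<zero>\<^bsub>P\<^esub> \<in> J" "\<zero>\<^bsub>P\<^esub> \<oplus>\<^bsub>P\<^esub> f \<in> J"
      unfolding J_def set_add_def' using zero_PIdl P.cgenideal_self g f(1) by blast+
    then have g_J: "g \<in> J" and f_J: "f \<in> J"
      using g f(1) by simp_all
    have J_P: "J \<subseteq> carrier P"
      using additive_subgroup.a_subset[OF ideal.axioms(1)[OF J]] .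
    obtain d where d: "d \<in> J" "d \<noteq> \<zero>\<^bsub>P\<^esub>"
      and d_least: "\<forall>q. q \<in> J \<and> q \<noteq> \<zero>\<^bsub>P\<^esub> \<longrightarrow> deg A d \<le> deg A q"
      using f_J f(2) ex_has_least_nat[of "\<lambda>q. q \<in> J \<and> q \<noteq> \<zero>\<^bsub>P\<^esub>" f "deg A"] by metis
    have d_min: "deg A d \<le> deg A q" if "q \<in> J" "q \<noteq> \<zero>\<^bsub>P\<^esub>" for q
      using that d_least by simp
    have d_P: "d \<in> carrier P"
      using d J_P by blast
    define m where "m = UnivPoly.coeff P d (deg A d)"
    have m: "m \<in> carrier A" "m \<noteq> \<zero>\<^bsub>A\<^esub>"
      using d_P d lcoeff_nonzero2 by (auto simp: m_def)
    have mk: "m [^]\<^bsub>A\<^esub> k \<noteq> \<zero>\<^bsub>A\<^esub>" for k :: nat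
      using m by (induction k) (auto simp: A.integral_iff)
    have d_dvd: "\<exists>q\<in>carrier P. \<exists>k::nat. m [^]\<^bsub>A\<^esub> k \<odot>\<^bsub>P\<^esub> p = d \<otimes>\<^bsub>P\<^esub> q" if p: "p \<in> J" for p
    proof -
      obtain q r and k :: nat where *: "q \<in> carrier P" "r \<in> carrier P"
        "m [^]\<^bsub>A\<^esub> k \<odot>\<^bsub>P\<^esub> p = d \<otimes>\<^bsub>P\<^esub> q \<oplus>\<^bsub>P\<^esub> r" "r = \<zero>\<^bsub>P\<^esub> \<or> deg A r < deg A d"
        using long_div_theorem[of d p] d d_P p J_P unfolding m_def by blast
      define t where "t = UnivPoly.monom P (m [^]\<^bsub>A\<^esub> k) 0"
      have t: "t \<in> carrier P"
        using m by (simp add: t_def)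
      have "t \<otimes>\<^bsub>P\<^esub> p = d \<otimes>\<^bsub>P\<^esub> q \<oplus>\<^bsub>P\<^esub> r"
        using * p J_P m by (auto simp: monom_mult_is_smult t_def)
      then have "r = t \<otimes>\<^bsub>P\<^esub> p \<ominus>\<^bsub>P\<^esub> d \<otimes>\<^bsub>P\<^esub> q"
        using *(1,2) d_P by (simp add: P.minus_eq P.a_ac P.r_neg P.r_neg1 P.r_neg2)
      also have "\<dots> \<in> J"
        unfolding P.minus_eq
        using ideal.I_l_closed[OF J p t] ideal.I_r_closed[OF J d(1) *(1)]
          ideal.axioms(1)[OF J] by (intro additive_subgroup.a_closed additive_subgroup.a_inv_closed) auto
      finally have "r = \<zero>\<^bsub>P\<^esub>"
        using d_min[of r] *(4) by (meson leD)
      then show ?thesis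
        using * d_P by auto
    qed
    have ev_smult: "ev (s \<odot>\<^bsub>P\<^esub> p) = h s \<otimes>\<^bsub>B\<^esub> ev p" if "s \<in> carrier A" "p \<in> carrier P" for s p
      using that by (simp add: monom_mult_is_smult[symmetric] ev_const)
    have ev_d: "ev d \<noteq> \<zero>\<^bsub>B\<^esub>"
    proof
      assume 0: "ev d = \<zero>\<^bsub>B\<^esub>"
      obtain q and k :: nat where *: "q \<in> carrier P" "m [^]\<^bsub>A\<^esub> k \<odot>\<^bsub>P\<^esub> g = d \<otimes>\<^bsub>P\<^esub> q"
        using d_dvd[OF g_J] by blast
      have "h (m [^]\<^bsub>A\<^esub> k) \<otimes>\<^bsub>B\<^esub> ev g = \<zero>\<^bsub>B\<^esub>"
        using arg_cong[OF *(2), of ev] *(1) d_P 0 m g by (simp add: ev_smult del: U.hom_pow)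
      then show False
        using b h_nz[OF _ mk[of k]] m g by (auto simp: B.integral_iff simp del: U.hom_pow)
    qed
    \<comment> \<open>As \<open>d\<close> does not vanish at \<open>x\<close>, the cofactor \<open>q\<close> of \<open>f\<close> does, and minimality of \<open>f\<close> leaves no degree
      for \<open>d\<close>.\<close>
    have deg_d: "deg A d = 0"
    proof -
      obtain q and k :: nat where *: "q \<in> carrier P" "m [^]\<^bsub>A\<^esub> k \<odot>\<^bsub>P\<^esub> f = d \<otimes>\<^bsub>P\<^esub> q"
        using d_dvd[OF f_J] by blast
      have "ev d \<otimes>\<^bsub>B\<^esub> ev q = \<zero>\<^bsub>B\<^esub>"
        using arg_cong[OF *(2), of ev] *(1) d_P f m by (simp add: ev_smult del: U.hom_pow)
      then have q0: "ev q = \<zero>\<^bsub>B\<^esub>"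
        using ev_d d_P * by (auto simp: B.integral_iff)
      have "d \<otimes>\<^bsub>P\<^esub> q \<noteq> \<zero>\<^bsub>P\<^esub>"
      proof -
        have "UnivPoly.coeff P (m [^]\<^bsub>A\<^esub> k \<odot>\<^bsub>P\<^esub> f) (deg A f) = m [^]\<^bsub>A\<^esub> k \<otimes>\<^bsub>A\<^esub> a"
          using m f by (simp add: a_def)
        moreover have "m [^]\<^bsub>A\<^esub> k \<otimes>\<^bsub>A\<^esub> a \<noteq> \<zero>\<^bsub>A\<^esub>"
          using a m mk[of k] by (simp add: A.integral_iff)
        ultimately have "m [^]\<^bsub>A\<^esub> k \<odot>\<^bsub>P\<^esub> f \<noteq> \<zero>\<^bsub>P\<^esub>"
          by (metis coeff_zero)
        then show ?thesis
          using *(2) by simp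
      qed
      then have qnz: "q \<noteq> \<zero>\<^bsub>P\<^esub>"
        using d_P by auto
      have "deg A f = deg A d + deg A q"
        using arg_cong[OF *(2), of "deg A"] *(1) d d_P f m mk qnz by simp
      then show ?thesis
        using f_min[OF _ qnz q0] * by simp
    qed
    then have d_const: "d = UnivPoly.monom P m 0"
      using deg_zero_impl_monom[OF d_P] by (simp add: m_def)
    obtain u v where uv: "u \<in> carrier P" "v \<in> carrier P" "d = u \<otimes>\<^bsub>P\<^esub> g \<oplus>\<^bsub>P\<^esub> v \<otimes>\<^bsub>P\<^esub> f"
      using d(1) by (auto simp: J_def set_add_def' cgenideal_def)
    have "a \<otimes>\<^bsub>A\<^esub> m \<noteq> \<zero>\<^bsub>A\<^esub>"
      using a m by (simp add: A.integral_iff)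
    then obtain \<phi> where \<phi>: "\<phi> \<in> ring_hom A L" and am: "\<phi> (a \<otimes>\<^bsub>A\<^esub> m) \<noteq> \<zero>\<^bsub>L\<^esub>"
      using sep a m unfolding points_separate_def by blast
    interpret V: UP_pre_univ_prop A L \<phi> P
      unfolding P_def using UP_pre_univ_propI[OF A.is_cring L.is_cring \<phi>] .
    have \<phi>a: "\<phi> a \<noteq> \<zero>\<^bsub>L\<^esub>" and \<phi>m: "\<phi> m \<noteq> \<zero>\<^bsub>L\<^esub>"
      using am a m by auto
    obtain \<alpha> where \<alpha>: "\<alpha> \<in> carrier L" "UnivPoly.eval A L \<phi> \<alpha> f = \<zero>\<^bsub>L\<^esub>"
      using L.ex_root_of_mapped_poly[OF A.is_cring \<phi>, of f] f deg_f \<phi>a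
      by (auto simp: P_def a_def)
    define ev' where "ev' = UnivPoly.eval A L \<phi> \<alpha>"
    interpret W: ring_hom_ring P L ev'
      unfolding ev'_def
      using P.ring_axioms L.ring_axioms V.eval_ring_hom[OF \<alpha>(1)] by (rule ring_hom_ringI2)
    have ev'_const: "ev' (UnivPoly.monom P s 0) = \<phi> s" if "s \<in> carrier A" for s
      unfolding ev'_def using that \<alpha> by (simp add: V.eval_const)
    have ev'_f: "ev' f = \<zero>\<^bsub>L\<^esub>"
      using \<alpha>(2) by (simp add: ev'_def)
    have ev'_g: "ev' g \<noteq> \<zero>\<^bsub>L\<^esub>"
    proof
      assume "ev' g = \<zero>\<^bsub>L\<^esub>"
      then have "ev' d = \<zero>\<^bsub>L\<^esub>"
        using uv g f ev'_f by simp
      then show False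
        using d_const ev'_const m \<phi>m by simp
    qed
    have ker: "ev' p = \<zero>\<^bsub>L\<^esub>" if p: "p \<in> carrier P" "ev p = \<zero>\<^bsub>B\<^esub>" for p
    proof -
      obtain q r and k :: nat where *: "q \<in> carrier P" "r \<in> carrier P"
        "a [^]\<^bsub>A\<^esub> k \<odot>\<^bsub>P\<^esub> p = f \<otimes>\<^bsub>P\<^esub> q \<oplus>\<^bsub>P\<^esub> r" "r = \<zero>\<^bsub>P\<^esub> \<or> deg A r < deg A f"
        using long_div_theorem[of f p] f p unfolding a_def by blast
      have "ev r = \<zero>\<^bsub>B\<^esub>"
        using arg_cong[OF *(3), of ev] *(1,2) f p a by (simp add: ev_smult del: U.hom_pow)
      then have "r = \<zero>\<^bsub>P\<^esub>"
        using f_min[of r] *(2,4) by (meson leD)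
      then have "ev' (UnivPoly.monom P (a [^]\<^bsub>A\<^esub> k) 0 \<otimes>\<^bsub>P\<^esub> p) = ev' (f \<otimes>\<^bsub>P\<^esub> q)"
        using * f p a by (simp add: monom_mult_is_smult)
      then have "\<phi> a [^]\<^bsub>L\<^esub> k \<otimes>\<^bsub>L\<^esub> ev' p = \<zero>\<^bsub>L\<^esub>"
        using * f p a ev'_f by (simp add: ev'_const)
      moreover have "\<phi> a [^]\<^bsub>L\<^esub> k \<noteq> \<zero>\<^bsub>L\<^esub>"
        using \<phi>a a by (induction k) (auto simp: L.integral_iff)
      ultimately show ?thesis
        using p a by (auto simp: L.integral_iff)
    qed
    show ?thesis
      by (rule extend[OF \<phi> \<alpha>(1) g]) (use ker ev'_g in \<open>auto simp: ev'_def\<close>)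
  qed
  then show ?thesis
    unfolding points_separate_def ev_def P_def by auto
qed

lemma (in domain) points_separate_finite_subset:
  assumes L: "algebraically_closed L" and K: "subring K R"
    and sep: "points_separate (R\<lparr>carrier := K\<rparr>) L"
    and A: "finite A" "A \<subseteq> carrier R"
  shows "\<exists>K'. subring K' R \<and> A \<subseteq> K' \<and> points_separate (R\<lparr>carrier := K'\<rparr>) L"
  using A
proof (induction A)
  case empty
  then show ?case
    using K sep by blast
next
  case (insert x A)
  then obtain K' where K': "subring K' R" "A \<subseteq> K'" and sep': "points_separate (R\<lparr>carrier := K'\<rparr>) L"
    by auto
  have x: "x \<in> carrier R"
    using insert by simp
  define B where "B = R\<lparr>carrier := K'\<rparr>"
  have carrier_B: "carrier B = K'"
    by (simp add: B_def)
  interpret B: domain B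
    unfolding B_def using subring_is_domain[OF K'(1)] .
  have id: "id \<in> ring_hom B R"
    using subringE(1)[OF K'(1)] by (intro ring_hom_memI) (auto simp: B_def)
  interpret U: UP_pre_univ_prop B R id "UP B"
    using UP_pre_univ_propI[OF B.is_cring is_cring id] .
  define e where "e = UnivPoly.eval B R id x"
  interpret e: ring_hom_ring "UP B" R e
    unfolding e_def using U.P.ring_axioms ring_axioms U.eval_ring_hom[OF x] by (rule ring_hom_ringI2)
  have "subring (e ` carrier (UP B)) R"
    by (rule e.img_is_subring[OF U.P.carrier_is_subring])
  moreover have "y \<in> e ` carrier (UP B)" if "y \<in> K'" for y
    using U.eval_const[OF x, of y] that
    by (intro image_eqI[of _ _ "UnivPoly.monom (UP B) y 0"]) (auto simp: e_def carrier_B)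
  moreover have "x \<in> e ` carrier (UP B)"
    using U.eval_monom1[OF x]
    by (intro image_eqI[of _ _ "UnivPoly.monom (UP B) \<one>\<^bsub>B\<^esub> 1"]) (auto simp: e_def)
  moreover have "points_separate (R\<lparr>carrier := e ` carrier (UP B)\<rparr>) L"
    unfolding e_def
    by (rule points_separate_adjoin) (use L x id sep' B.domain_axioms domain_axioms in \<open>auto simp: B_def\<close>)
  ultimately show ?case
    using K'(2) by (intro exI[of _ "e ` carrier (UP B)"]) auto
qed

text \<open>
  A homomorphism that does not kill a common multiple of all differences of distinct elements of \<open>A\<close>
  kills none of these differences. In a domain, finitely many nonzero elements have a nonzero common
  multiple.
\<close>
lemma points_separate_imp_inj_on:
  assumes B: "domain B" and L: "domain L" and sep: "points_separate B L"
    and A: "finite A" "A \<subseteq> carrier B"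
  shows "\<exists>\<phi>\<in>ring_hom B L. inj_on \<phi> A"
proof -
  interpret B: domain B by fact
  interpret L: domain L by fact
  have "\<exists>b\<in>carrier B. b \<noteq> \<zero>\<^bsub>B\<^esub> \<and> (\<forall>d\<in>D. \<exists>c\<in>carrier B. b = c \<otimes>\<^bsub>B\<^esub> d)"
    if "finite D" "D \<subseteq> carrier B - {\<zero>\<^bsub>B\<^esub>}" for D
    using that
  proof (induction D)
    case empty
    show ?case
      by (intro bexI[of _ "\<one>\<^bsub>B\<^esub>"]) auto
  next
    case (insert d D)
    then obtain b where b: "b \<in> carrier B" "b \<noteq> \<zero>\<^bsub>B\<^esub>" "\<forall>d\<in>D. \<exists>c\<in>carrier B. b = c \<otimes>\<^bsub>B\<^esub> d"
      by auto
    have d: "d \<in> carrier B" "d \<noteq> \<zero>\<^bsub>B\<^esub>"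
      using insert by auto
    have "\<exists>c\<in>carrier B. b \<otimes>\<^bsub>B\<^esub> d = c \<otimes>\<^bsub>B\<^esub> d'" if d': "d' \<in> insert d D" for d'
    proof (cases "d' = d")
      case True
      then show ?thesis
        using b by auto
    next
      case False
      then obtain c where c: "c \<in> carrier B" "b = c \<otimes>\<^bsub>B\<^esub> d'"
        using b(3) d' by auto
      have "d' \<in> carrier B"
        using d' insert by auto
      then show ?thesis
        using c d by (intro bexI[of _ "c \<otimes>\<^bsub>B\<^esub> d"]) (simp_all add: B.m_ac)
    qed
    then show ?case
      using b d by (intro bexI[of _ "b \<otimes>\<^bsub>B\<^esub> d"]) (simp_all add: B.integral_iff)
  qed
  note common_multiple = this
  define D where "D = (\<lambda>(x, y). x \<ominus>\<^bsub>B\<^esub> y) ` {(x, y). x \<in> A \<and> y \<in> A \<and> x \<noteq> y}"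
  have "finite {(x, y). x \<in> A \<and> y \<in> A \<and> x \<noteq> y}"
    by (rule finite_subset[of _ "A \<times> A"]) (use A in auto)
  then have "finite D"
    by (simp add: D_def)
  moreover have "D \<subseteq> carrier B - {\<zero>\<^bsub>B\<^esub>}"
    using A by (auto simp: D_def subset_iff)
  ultimately obtain b where b: "b \<in> carrier B" "b \<noteq> \<zero>\<^bsub>B\<^esub>" "\<forall>d\<in>D. \<exists>c\<in>carrier B. b = c \<otimes>\<^bsub>B\<^esub> d"
    using common_multiple by blast
  then obtain \<phi> where \<phi>: "\<phi> \<in> ring_hom B L" "\<phi> b \<noteq> \<zero>\<^bsub>L\<^esub>"
    using sep by (auto simp: points_separate_def)
  interpret \<phi>: ring_hom_ring B L \<phi>
    using B.ring_axioms L.ring_axioms \<phi>(1) by (rule ring_hom_ringI2)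
  have "inj_on \<phi> A"
  proof (rule inj_onI, rule ccontr)
    fix x y assume xy: "x \<in> A" "y \<in> A" "\<phi> x = \<phi> y" "x \<noteq> y"
    then have xyB: "x \<in> carrier B" "y \<in> carrier B"
      using A by auto
    obtain c where c: "c \<in> carrier B" "b = c \<otimes>\<^bsub>B\<^esub> (x \<ominus>\<^bsub>B\<^esub> y)"
      using b(3) xy by (auto simp: D_def)
    have "\<phi> (x \<ominus>\<^bsub>B\<^esub> y) = \<zero>\<^bsub>L\<^esub>"
      using xy(3) xyB by (simp add: a_minus_def L.r_neg)
    then show False
      using \<phi>(2) c xyB by simp
  qed
  then show ?thesis
    using \<phi>(1) by blast
qed

section \<open>Embedding into finite fields\<close>

lemma (in ring) finite_dimension_imp_finite:
  assumes K: "subfield K R" "finite K" and E: "finite_dimension K E"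
  shows "finite E"
proof -
  obtain n where "dimension n K E"
    using E by blast
  then obtain Vs where Vs: "set Vs \<subseteq> carrier R" "Span K Vs = E"
    using exists_base[OF K(1)] by blast
  have "E = (\<lambda>Ks. combine Ks Vs) ` {Ks. set Ks \<subseteq> K \<and> length Ks = length Vs}"
    using Span_eq_combine_set_length_version[OF K(1) Vs(1)] Vs(2) by auto
  then show ?thesis
    using finite_lists_length_eq[OF K(2)] by simp
qed

lemma (in algebraic_closure) finite_set_in_finite_subfield:
  assumes "finite K" and "finite A" and A: "A \<subseteq> carrier L"
  shows "\<exists>E. subfield E L \<and> finite E \<and> A \<subseteq> E"
proof -
  obtain xs where xs: "set xs = A"
    using finite_list[OF assms(2)] by blast
  then have xs_L: "set xs \<subseteq> carrier L"
    using A by simp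
  have alg: "(algebraic over K) x" if "x \<in> set xs" for x
    using that xs_L algebraic_extension by auto
  have "subfield (finite_extension K xs) L"
    using finite_extension_is_subfield[OF subfield_axioms xs_L alg] .
  moreover have "finite (finite_extension K xs)"
    using finite_dimension_imp_finite[OF subfield_axioms assms(1)
        finite_extension_finite_dimension(1)[OF subfield_axioms xs_L alg]] .
  moreover have "A \<subseteq> finite_extension K xs"
    using finite_extension_mem[OF subfieldE(1)[OF subfield_axioms] xs_L] xs by simp
  ultimately show ?thesis
    by blast
qed

lemma locally_embeddable_inj_homs:
  assumes loc: "locally_embeddable R C"
    and homs: "\<And>S. S \<in> C \<Longrightarrow> \<exists>T\<in>D. \<exists>h\<in>ring_hom S T. inj_on h (carrier S)"
  shows "locally_embeddable R D"
  unfolding locally_embeddable_def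
proof (intro allI impI)
  fix A assume A: "finite A \<and> A \<subseteq> carrier R"
  then obtain S f where S: "S \<in> C" and f: "f \<in> A \<rightarrow> carrier S"
    "\<forall>x\<in>A. \<forall>y\<in>A. x \<oplus>\<^bsub>R\<^esub> y \<in> A \<longrightarrow> f (x \<oplus>\<^bsub>R\<^esub> y) = f x \<oplus>\<^bsub>S\<^esub> f y"
    "\<forall>x\<in>A. \<forall>y\<in>A. x \<otimes>\<^bsub>R\<^esub> y \<in> A \<longrightarrow> f (x \<otimes>\<^bsub>R\<^esub> y) = f x \<otimes>\<^bsub>S\<^esub> f y"
    "inj_on f A" "\<one>\<^bsub>R\<^esub> \<in> A \<longrightarrow> f \<one>\<^bsub>R\<^esub> = \<one>\<^bsub>S\<^esub>"
    using mp[OF spec[OF loc[unfolded locally_embeddable_def], of A] A] by blast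
  obtain T h where T: "T \<in> D" and h: "h \<in> ring_hom S T" "inj_on h (carrier S)"
    using homs[OF S] by blast
  have "inj_on (h \<circ> f) A"
    using f(1) by (intro comp_inj_on[OF f(4)] inj_on_subset[OF h(2)]) auto
  moreover have "h (f x) \<in> carrier T" if "x \<in> A" for x
    using that f(1) ring_hom_memE(1)[OF h(1)] by auto
  moreover have "h (f (x \<oplus>\<^bsub>R\<^esub> y)) = h (f x) \<oplus>\<^bsub>T\<^esub> h (f y)"
    if "x \<in> A" "y \<in> A" "x \<oplus>\<^bsub>R\<^esub> y \<in> A" for x y
    using that f(1,2) ring_hom_memE(3)[OF h(1), of "f x" "f y"] by auto
  moreover have "h (f (x \<otimes>\<^bsub>R\<^esub> y)) = h (f x) \<otimes>\<^bsub>T\<^esub> h (f y)"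
    if "x \<in> A" "y \<in> A" "x \<otimes>\<^bsub>R\<^esub> y \<in> A" for x y
    using that f(1,3) ring_hom_memE(2)[OF h(1), of "f x" "f y"] by auto
  moreover have "h (f \<one>\<^bsub>R\<^esub>) = \<one>\<^bsub>T\<^esub>" if "\<one>\<^bsub>R\<^esub> \<in> A"
    using that f(5) ring_hom_memE(4)[OF h(1)] by simp
  ultimately show "\<exists>S\<in>D. \<exists>f. f \<in> A \<rightarrow> carrier S \<and>
      (\<forall>x\<in>A. \<forall>y\<in>A. x \<oplus>\<^bsub>R\<^esub> y \<in> A \<longrightarrow> f (x \<oplus>\<^bsub>R\<^esub> y) = f x \<oplus>\<^bsub>S\<^esub> f y) \<and>
      (\<forall>x\<in>A. \<forall>y\<in>A. x \<otimes>\<^bsub>R\<^esub> y \<in> A \<longrightarrow> f (x \<otimes>\<^bsub>R\<^esub> y) = f x \<otimes>\<^bsub>S\<^esub> f y) \<and>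
      inj_on f A \<and> (\<one>\<^bsub>R\<^esub> \<in> A \<longrightarrow> f \<one>\<^bsub>R\<^esub> = \<one>\<^bsub>S\<^esub>)"
    using T by (intro bexI[of _ T] exI[of _ "h \<circ> f"]) simp_all
qed

text \<open>
  The closure \<open>L\<close> is taken over the residue ring and not over \<open>F\<close>, so that all of its elements are
  algebraic over a finite field.
\<close>
lemma locally_embeddable_finite_fields:
  fixes F :: "('a, 'm) ring_scheme"
  assumes F: "field F" and char: "characteristic F > 0"
  shows "locally_embeddable F (finite_fields (characteristic F))"
proof -
  interpret F: field F by fact
  define p where "p = characteristic F"
  define k where "k = residue_ring (int p)"
  define \<eta> where "\<eta> = (\<lambda>i. [(nat i)] \<cdot>\<^bsub>F\<^esub> \<one>\<^bsub>F\<^esub>)"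
  have p: "Factorial_Ring.prime p"
    unfolding p_def using F.prime_characteristic[OF char] .
  interpret k: residues_prime p k
    unfolding k_def by unfold_locales (rule p)
  have \<eta>: "\<eta> \<in> ring_hom k F" "inj_on \<eta> (carrier k)"
    using residue_ring_hom[OF F.ring_axioms] residue_ring_hom_inj[OF F.ring_axioms char]
      prime_gt_1_nat[OF p] by (simp_all add: \<eta>_def k_def p_def)
  define L where "L = k.alg_closure"
  define \<iota> where "\<iota> = (k.indexed_const :: int \<Rightarrow> (int list \<times> nat) multiset \<Rightarrow> int)"
  interpret L: algebraic_closure L "\<iota> ` carrier k"
    unfolding L_def \<iota>_def by (rule k.alg_closureE(1))
  have \<iota>: "\<iota> \<in> ring_hom k L" "inj_on \<iota> (carrier k)"
    unfolding L_def \<iota>_def by (rule k.alg_closureE(2), rule k.indexed_const_inj_on)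
  have char_L: "characteristic L = p"
    using characteristic_inj_hom[OF k.ring_axioms L.ring_axioms \<iota>]
      characteristic_inj_hom[OF k.ring_axioms F.ring_axioms \<eta>] by (simp add: p_def)

  interpret \<eta>: ring_hom_ring k F \<eta>
    using k.ring_axioms F.ring_axioms \<eta>(1) by (rule ring_hom_ringI2)
  interpret \<iota>: ring_hom_ring k L \<iota>
    using k.ring_axioms L.ring_axioms \<iota>(1) by (rule ring_hom_ringI2)
  have zero: "i = \<zero>\<^bsub>k\<^esub>" if "i \<in> carrier k" "\<eta> i = \<zero>\<^bsub>F\<^esub> \<or> \<iota> i = \<zero>\<^bsub>L\<^esub>" for i
    using that inj_onD[OF \<eta>(2), of i "\<zero>\<^bsub>k\<^esub>"] inj_onD[OF \<iota>(2), of i "\<zero>\<^bsub>k\<^esub>"] by auto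
  \<comment> \<open>The prime field of \<open>F\<close> embeds into \<open>L\<close>, which starts the induction over generators.\<close>
  obtain \<psi> where \<psi>: "\<psi> \<in> ring_hom (F\<lparr>carrier := \<eta> ` carrier k\<rparr>) L"
    "\<And>i. i \<in> carrier k \<Longrightarrow> \<psi> (\<eta> i) = \<iota> i"
    by (rule hom_factors_through_image[OF k.ring_axioms F.ring_axioms L.ring_axioms \<eta>(1) \<iota>(1)])
      (use zero \<iota>.hom_zero in auto)
  have "points_separate (F\<lparr>carrier := \<eta> ` carrier k\<rparr>) L"
    unfolding points_separate_def
  proof (intro ballI impI bexI[of _ \<psi>])
    fix b assume "b \<in> carrier (F\<lparr>carrier := \<eta> ` carrier k\<rparr>)" "b \<noteq> \<zero>\<^bsub>F\<lparr>carrier := \<eta> ` carrier k\<rparr>\<^esub>"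
    then obtain i where i: "i \<in> carrier k" "b = \<eta> i" "\<eta> i \<noteq> \<zero>\<^bsub>F\<^esub>"
      by auto
    then have "\<iota> i \<noteq> \<zero>\<^bsub>L\<^esub>"
      using zero[of i] \<eta>.hom_zero by metis
    then show "\<psi> b \<noteq> \<zero>\<^bsub>L\<^esub>"
      using i \<psi>(2) by simp
  qed (rule \<psi>(1))
  note sep = this

  define C where "C = {L\<lparr>carrier := E\<rparr> | E. subfield E L \<and> finite E}"
  have "locally_embeddable F C"
    unfolding locally_embeddable_def
  proof (intro allI impI)
    fix A assume A: "finite A \<and> A \<subseteq> carrier F"
    then obtain K where K: "subring K F" "A \<subseteq> K" "points_separate (F\<lparr>carrier := K\<rparr>) L"
      using F.points_separate_finite_subset[OF L.algebraically_closed_axioms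
          \<eta>.img_is_subring[OF k.carrier_is_subring] sep] by blast
    then obtain \<phi> where \<phi>: "\<phi> \<in> ring_hom (F\<lparr>carrier := K\<rparr>) L" "inj_on \<phi> A"
      using points_separate_imp_inj_on[OF F.subring_is_domain[OF K(1)] L.domain_axioms K(3), of A] A
      by auto
    have \<phi>_L: "\<phi> ` A \<subseteq> carrier L"
      using K(2) ring_hom_memE(1)[OF \<phi>(1)] by auto
    have "finite (\<iota> ` carrier k)" "finite (\<phi> ` A)"
      using A by simp_all
    then obtain E where E: "subfield E L" "finite E" "\<phi> ` A \<subseteq> E"
      using L.finite_set_in_finite_subfield[OF _ _ \<phi>_L] by blast
    have "\<phi> (x \<oplus>\<^bsub>F\<^esub> y) = \<phi> x \<oplus>\<^bsub>L\<^esub> \<phi> y" "\<phi> (x \<otimes>\<^bsub>F\<^esub> y) = \<phi> x \<otimes>\<^bsub>L\<^esub> \<phi> y"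
      if "x \<in> A" "y \<in> A" for x y
      using that K(2) ring_hom_memE(2,3)[OF \<phi>(1), of x y] by auto
    moreover have "\<phi> \<one>\<^bsub>F\<^esub> = \<one>\<^bsub>L\<^esub>"
      using ring_hom_memE(4)[OF \<phi>(1)] by simp
    moreover have "L\<lparr>carrier := E\<rparr> \<in> C"
      using E by (auto simp: C_def)
    ultimately show "\<exists>S\<in>C. \<exists>f. f \<in> A \<rightarrow> carrier S \<and>
        (\<forall>x\<in>A. \<forall>y\<in>A. x \<oplus>\<^bsub>F\<^esub> y \<in> A \<longrightarrow> f (x \<oplus>\<^bsub>F\<^esub> y) = f x \<oplus>\<^bsub>S\<^esub> f y) \<and>
        (\<forall>x\<in>A. \<forall>y\<in>A. x \<otimes>\<^bsub>F\<^esub> y \<in> A \<longrightarrow> f (x \<otimes>\<^bsub>F\<^esub> y) = f x \<otimes>\<^bsub>S\<^esub> f y) \<and>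
        inj_on f A \<and> (\<one>\<^bsub>F\<^esub> \<in> A \<longrightarrow> f \<one>\<^bsub>F\<^esub> = \<one>\<^bsub>S\<^esub>)"
      using \<phi>(2) E(3) by (intro bexI[of _ "L\<lparr>carrier := E\<rparr>"] exI[of _ \<phi>]) auto
  qed
  then have "locally_embeddable F (finite_fields p)"
  proof (rule locally_embeddable_inj_homs)
    fix S assume "S \<in> C"
    then obtain E where E: "subfield E L" "finite E" and S: "S = L\<lparr>carrier := E\<rparr>"
      by (auto simp: C_def)
    interpret S: field S
      unfolding S using L.subfield_iff(2)[OF E(1)] .
    have "id \<in> ring_hom S L"
      unfolding S using subfieldE(3)[OF E(1)] by (intro ring_hom_memI) auto
    then have "characteristic S = p"
      using characteristic_inj_hom[OF S.ring_axioms L.ring_axioms] char_L by simp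
    then obtain T h where "T \<in> finite_fields p" and "h \<in> ring_iso S T"
      using finite_field_iso_nat[OF S.field_axioms] E(2) by (auto simp: S is_ring_iso_def)
    then show "\<exists>T\<in>finite_fields p. \<exists>h\<in>ring_hom S T. inj_on h (carrier S)"
      by (auto simp: ring_iso_def bij_betw_def)
  qed
  then show ?thesis
    by (simp add: p_def)
qed

section \<open>Embedding finite fields into matrix rings\<close>

lemma (in abelian_monoid) finsum_swap:
  assumes "finite I" "finite J" "\<And>i j. i \<in> I \<Longrightarrow> j \<in> J \<Longrightarrow> f i j \<in> carrier G"
  shows "(\<Oplus>i\<in>I. \<Oplus>j\<in>J. f i j) = (\<Oplus>j\<in>J. \<Oplus>i\<in>I. f i j)"
  using assms(1,3)
proof (induction I)
  case (insert x I)
  have "(\<Oplus>j\<in>J. \<Oplus>i\<in>insert x I. f i j) = (\<Oplus>j\<in>J. f x j \<oplus> (\<Oplus>i\<in>I. f i j))"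
    by (rule finsum_cong') (use insert in \<open>auto simp: Pi_def\<close>)
  also have "\<dots> = (\<Oplus>j\<in>J. f x j) \<oplus> (\<Oplus>j\<in>J. \<Oplus>i\<in>I. f i j)"
    by (rule finsum_addf) (use insert in \<open>auto simp: Pi_def\<close>)
  finally show ?case
    using insert by (simp add: Pi_def)
qed simp

text \<open>
  The left regular representation: \<open>a\<close> is sent to the matrix whose \<open>j\<close>-th column holds the coordinates
  of \<open>a\<close> times the \<open>j\<close>-th basis vector. It is faithful because the unit of \<open>S\<close> is a linear
  combination of the basis vectors, so that \<open>a\<close> can be recovered from its action on them.
\<close>
lemma regular_representation:
  fixes k :: "('a, 'm) ring_scheme" and S :: "('b, 'n) ring_scheme"
  assumes k: "ring k" and S: "cring S" and \<eta>: "\<eta> \<in> ring_hom k S"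
    and v: "v \<in> {..<d} \<rightarrow> carrier S"
    and span: "\<And>s. s \<in> carrier S \<Longrightarrow>
      \<exists>c\<in>{..<d} \<rightarrow> carrier k. s = (\<Oplus>\<^bsub>S\<^esub>i\<in>{..<d}. \<eta> (c i) \<otimes>\<^bsub>S\<^esub> v i)"
    and indep: "\<And>c c'. c \<in> {..<d} \<rightarrow> carrier k \<Longrightarrow> c' \<in> {..<d} \<rightarrow> carrier k \<Longrightarrow>
      (\<Oplus>\<^bsub>S\<^esub>i\<in>{..<d}. \<eta> (c i) \<otimes>\<^bsub>S\<^esub> v i) = (\<Oplus>\<^bsub>S\<^esub>i\<in>{..<d}. \<eta> (c' i) \<otimes>\<^bsub>S\<^esub> v i) \<Longrightarrow>
      \<forall>i<d. c i = c' i"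
  shows "\<exists>f\<in>ring_hom S (matrix_ring k d). inj_on f (carrier S)"
proof -
  interpret k: ring k by fact
  interpret S: cring S by fact
  interpret \<eta>: ring_hom_ring k S \<eta>
    using k S.ring_axioms \<eta> by (rule ring_hom_ringI2)
  let ?M = "carrier (matrix_ring k d)"
  have v': "v i \<in> carrier S" if "i < d" for i
    using v that by auto
  have entry: "A $$ (i, j) \<in> carrier k" if "A \<in> ?M" "i < d" "j < d" for A i j
    using that by (simp add: matrix_ring_def)
  \<comment> \<open>Working with the relation "\<open>A\<close> is the matrix of multiplication by \<open>a\<close>" reduces each homomorphism
    law to the uniqueness of coordinates.\<close>
  define rep where "rep = (\<lambda>a A. A \<in> ?M \<and>
    (\<forall>j<d. a \<otimes>\<^bsub>S\<^esub> v j = (\<Oplus>\<^bsub>S\<^esub>i\<in>{..<d}. \<eta> (A $$ (i, j)) \<otimes>\<^bsub>S\<^esub> v i)))"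
  have repM: "A \<in> ?M" if "rep a A" for a A
    using that by (simp add: rep_def)
  have repD: "a \<otimes>\<^bsub>S\<^esub> v j = (\<Oplus>\<^bsub>S\<^esub>i\<in>{..<d}. \<eta> (A $$ (i, j)) \<otimes>\<^bsub>S\<^esub> v i)"
    if "rep a A" "j < d" for a A j
    using that by (simp add: rep_def)
  have rep_unique: "A = B" if "rep a A" "rep a B" for a A B
  proof -
    have "A $$ (i, j) = B $$ (i, j)" if ij: "i < d" "j < d" for i j
    proof -
      have "\<forall>i<d. A $$ (i, j) = B $$ (i, j)"
        by (rule indep) (use ij repD[OF \<open>rep a A\<close>] repD[OF \<open>rep a B\<close>]
            entry repM[OF \<open>rep a A\<close>] repM[OF \<open>rep a B\<close>] in auto)
      then show ?thesis
        using ij by blast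
    qed
    then show ?thesis
      using repM[OF that(1)] repM[OF that(2)] by (intro eq_matI) (auto simp: matrix_ring_def)
  qed
  have rep_ex: "\<exists>A. rep a A" if a: "a \<in> carrier S" for a
  proof -
    have "\<forall>j\<in>{..<d}. \<exists>c. c \<in> {..<d} \<rightarrow> carrier k \<and>
        a \<otimes>\<^bsub>S\<^esub> v j = (\<Oplus>\<^bsub>S\<^esub>i\<in>{..<d}. \<eta> (c i) \<otimes>\<^bsub>S\<^esub> v i)"
      using span a v' by (metis S.m_closed lessThan_iff)
    then obtain c where c: "\<And>j. j < d \<Longrightarrow> c j \<in> {..<d} \<rightarrow> carrier k"
      "\<And>j. j < d \<Longrightarrow> a \<otimes>\<^bsub>S\<^esub> v j = (\<Oplus>\<^bsub>S\<^esub>i\<in>{..<d}. \<eta> (c j i) \<otimes>\<^bsub>S\<^esub> v i)"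
      unfolding bchoice_iff by auto
    have "rep a (mat d d (\<lambda>(i, j). c j i))"
      unfolding rep_def
    proof (intro conjI allI impI)
      show "mat d d (\<lambda>(i, j). c j i) \<in> ?M"
        using c(1) by (auto simp: matrix_ring_def Pi_def)
      fix j assume j: "j < d"
      show "a \<otimes>\<^bsub>S\<^esub> v j = (\<Oplus>\<^bsub>S\<^esub>i\<in>{..<d}. \<eta> (mat d d (\<lambda>(i, j). c j i) $$ (i, j)) \<otimes>\<^bsub>S\<^esub> v i)"
        unfolding c(2)[OF j] by (rule S.finsum_cong') (use j c(1) v' in \<open>auto simp: Pi_def\<close>)
    qed
    then show ?thesis by blast
  qed
  have rep_inj: "a = b" if "rep a A" "rep b A" "a \<in> carrier S" "b \<in> carrier S" for a b A
  proof -
    obtain c where c: "c \<in> {..<d} \<rightarrow> carrier k"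
      "\<one>\<^bsub>S\<^esub> = (\<Oplus>\<^bsub>S\<^esub>i\<in>{..<d}. \<eta> (c i) \<otimes>\<^bsub>S\<^esub> v i)"
      using span[of "\<one>\<^bsub>S\<^esub>"] by auto
    have *: "x = (\<Oplus>\<^bsub>S\<^esub>i\<in>{..<d}. \<eta> (c i) \<otimes>\<^bsub>S\<^esub> (x \<otimes>\<^bsub>S\<^esub> v i))" if x: "x \<in> carrier S" for x
    proof -
      have "x = x \<otimes>\<^bsub>S\<^esub> (\<Oplus>\<^bsub>S\<^esub>i\<in>{..<d}. \<eta> (c i) \<otimes>\<^bsub>S\<^esub> v i)"
        using x c(2) by (metis S.r_one)
      also have "\<dots> = (\<Oplus>\<^bsub>S\<^esub>i\<in>{..<d}. x \<otimes>\<^bsub>S\<^esub> (\<eta> (c i) \<otimes>\<^bsub>S\<^esub> v i))"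
        using x c(1) v' by (intro S.finsum_rdistr) (auto simp: Pi_def)
      also have "\<dots> = (\<Oplus>\<^bsub>S\<^esub>i\<in>{..<d}. \<eta> (c i) \<otimes>\<^bsub>S\<^esub> (x \<otimes>\<^bsub>S\<^esub> v i))"
        using x c(1) v' by (intro S.finsum_cong') (auto simp: Pi_def S.m_lcomm)
      finally show ?thesis .
    qed
    have "(\<Oplus>\<^bsub>S\<^esub>i\<in>{..<d}. \<eta> (c i) \<otimes>\<^bsub>S\<^esub> (a \<otimes>\<^bsub>S\<^esub> v i)) = (\<Oplus>\<^bsub>S\<^esub>i\<in>{..<d}. \<eta> (c i) \<otimes>\<^bsub>S\<^esub> (b \<otimes>\<^bsub>S\<^esub> v i))"
    proof (rule S.finsum_cong')
      fix i assume i: "i \<in> {..<d}"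
      then show "\<eta> (c i) \<otimes>\<^bsub>S\<^esub> (a \<otimes>\<^bsub>S\<^esub> v i) = \<eta> (c i) \<otimes>\<^bsub>S\<^esub> (b \<otimes>\<^bsub>S\<^esub> v i)"
        using repD[OF that(1), of i] repD[OF that(2), of i] by simp
    qed (use c(1) v' that in \<open>auto simp: Pi_def\<close>)
    then show ?thesis
      using *[OF that(3)] *[OF that(4)] by simp
  qed
  have rep_one: "rep \<one>\<^bsub>S\<^esub> \<one>\<^bsub>matrix_ring k d\<^esub>"
    unfolding rep_def
  proof (intro conjI allI impI)
    show "\<one>\<^bsub>matrix_ring k d\<^esub> \<in> ?M"
      using ring_matrix_ring[OF k] by (simp add: ring.ring_simprules)
    fix j assume j: "j < d"
    have "(\<Oplus>\<^bsub>S\<^esub>i\<in>{..<d}. \<eta> (\<one>\<^bsub>matrix_ring k d\<^esub> $$ (i, j)) \<otimes>\<^bsub>S\<^esub> v i)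
        = (\<Oplus>\<^bsub>S\<^esub>i\<in>{..<d}. if j = i then v i else \<zero>\<^bsub>S\<^esub>)"
      by (rule S.finsum_cong') (use j v' in \<open>auto simp: matrix_ring_def\<close>)
    also have "\<dots> = v j"
      using S.add.finprod_singleton[of j "{..<d}" v] j v by simp
    finally show "\<one>\<^bsub>S\<^esub> \<otimes>\<^bsub>S\<^esub> v j = (\<Oplus>\<^bsub>S\<^esub>i\<in>{..<d}. \<eta> (\<one>\<^bsub>matrix_ring k d\<^esub> $$ (i, j)) \<otimes>\<^bsub>S\<^esub> v i)"
      using v' j by simp
  qed
  have rep_add: "rep (a \<oplus>\<^bsub>S\<^esub> b) (A \<oplus>\<^bsub>matrix_ring k d\<^esub> B)"
    if "rep a A" "rep b B" "a \<in> carrier S" "b \<in> carrier S" for a b A B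
    unfolding rep_def
  proof (intro conjI allI impI)
    note A = entry[OF repM[OF that(1)]] and B = entry[OF repM[OF that(2)]]
    show "A \<oplus>\<^bsub>matrix_ring k d\<^esub> B \<in> ?M"
      using ring_matrix_ring[OF k] repM that by (blast intro: ring.ring_simprules)
    fix j assume j: "j < d"
    have "(a \<oplus>\<^bsub>S\<^esub> b) \<otimes>\<^bsub>S\<^esub> v j =
      (\<Oplus>\<^bsub>S\<^esub>i\<in>{..<d}. \<eta> (A $$ (i, j)) \<otimes>\<^bsub>S\<^esub> v i) \<oplus>\<^bsub>S\<^esub> (\<Oplus>\<^bsub>S\<^esub>i\<in>{..<d}. \<eta> (B $$ (i, j)) \<otimes>\<^bsub>S\<^esub> v i)"
      using that j v' by (simp add: S.l_distr repD)
    also have "\<dots> = (\<Oplus>\<^bsub>S\<^esub>i\<in>{..<d}. \<eta> (A $$ (i, j)) \<otimes>\<^bsub>S\<^esub> v i \<oplus>\<^bsub>S\<^esub> \<eta> (B $$ (i, j)) \<otimes>\<^bsub>S\<^esub> v i)"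
      by (rule S.finsum_addf[symmetric]) (use A B j v' in \<open>auto simp: Pi_def\<close>)
    also have "\<dots> = (\<Oplus>\<^bsub>S\<^esub>i\<in>{..<d}. \<eta> ((A \<oplus>\<^bsub>matrix_ring k d\<^esub> B) $$ (i, j)) \<otimes>\<^bsub>S\<^esub> v i)"
      by (rule S.finsum_cong') (use A B j v' in \<open>auto simp: Pi_def matrix_ring_def S.l_distr\<close>)
    finally show "(a \<oplus>\<^bsub>S\<^esub> b) \<otimes>\<^bsub>S\<^esub> v j =
      (\<Oplus>\<^bsub>S\<^esub>i\<in>{..<d}. \<eta> ((A \<oplus>\<^bsub>matrix_ring k d\<^esub> B) $$ (i, j)) \<otimes>\<^bsub>S\<^esub> v i)" .
  qed
  have rep_mult: "rep (a \<otimes>\<^bsub>S\<^esub> b) (A \<otimes>\<^bsub>matrix_ring k d\<^esub> B)"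
    if "rep a A" "rep b B" "a \<in> carrier S" "b \<in> carrier S" for a b A B
    unfolding rep_def
  proof (intro conjI allI impI)
    note A = entry[OF repM[OF that(1)]] and B = entry[OF repM[OF that(2)]]
    show "A \<otimes>\<^bsub>matrix_ring k d\<^esub> B \<in> ?M"
      using ring_matrix_ring[OF k] repM that by (blast intro: ring.ring_simprules)
    fix j assume j: "j < d"
    have "(a \<otimes>\<^bsub>S\<^esub> b) \<otimes>\<^bsub>S\<^esub> v j = a \<otimes>\<^bsub>S\<^esub> (\<Oplus>\<^bsub>S\<^esub>l\<in>{..<d}. \<eta> (B $$ (l, j)) \<otimes>\<^bsub>S\<^esub> v l)"
      using that j v' by (simp add: S.m_assoc repD)
    also have "\<dots> = (\<Oplus>\<^bsub>S\<^esub>l\<in>{..<d}. a \<otimes>\<^bsub>S\<^esub> (\<eta> (B $$ (l, j)) \<otimes>\<^bsub>S\<^esub> v l))"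
      by (rule S.finsum_rdistr) (use that B j v' in \<open>auto simp: Pi_def\<close>)
    also have "\<dots> = (\<Oplus>\<^bsub>S\<^esub>l\<in>{..<d}. \<Oplus>\<^bsub>S\<^esub>i\<in>{..<d}. \<eta> (A $$ (i, l)) \<otimes>\<^bsub>S\<^esub> \<eta> (B $$ (l, j)) \<otimes>\<^bsub>S\<^esub> v i)"
    proof (rule S.finsum_cong')
      fix l assume "l \<in> {..<d}"
      then have l: "l < d" by simp
      have "a \<otimes>\<^bsub>S\<^esub> (\<eta> (B $$ (l, j)) \<otimes>\<^bsub>S\<^esub> v l) = \<eta> (B $$ (l, j)) \<otimes>\<^bsub>S\<^esub> (a \<otimes>\<^bsub>S\<^esub> v l)"
        using that B[OF l j] v'[OF l] by (simp add: S.m_lcomm)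
      also have "\<dots> = \<eta> (B $$ (l, j)) \<otimes>\<^bsub>S\<^esub> (\<Oplus>\<^bsub>S\<^esub>i\<in>{..<d}. \<eta> (A $$ (i, l)) \<otimes>\<^bsub>S\<^esub> v i)"
        using repD[OF that(1) l] by simp
      also have "\<dots> = (\<Oplus>\<^bsub>S\<^esub>i\<in>{..<d}. \<eta> (B $$ (l, j)) \<otimes>\<^bsub>S\<^esub> (\<eta> (A $$ (i, l)) \<otimes>\<^bsub>S\<^esub> v i))"
        by (rule S.finsum_rdistr) (use A B j l v' in \<open>auto simp: Pi_def\<close>)
      also have "\<dots> = (\<Oplus>\<^bsub>S\<^esub>i\<in>{..<d}. \<eta> (A $$ (i, l)) \<otimes>\<^bsub>S\<^esub> \<eta> (B $$ (l, j)) \<otimes>\<^bsub>S\<^esub> v i)"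
        by (rule S.finsum_cong') (use A B j l v' in \<open>auto simp: Pi_def S.m_ac\<close>)
      finally show "a \<otimes>\<^bsub>S\<^esub> (\<eta> (B $$ (l, j)) \<otimes>\<^bsub>S\<^esub> v l) =
        (\<Oplus>\<^bsub>S\<^esub>i\<in>{..<d}. \<eta> (A $$ (i, l)) \<otimes>\<^bsub>S\<^esub> \<eta> (B $$ (l, j)) \<otimes>\<^bsub>S\<^esub> v i)" .
    qed (use A B j v' in \<open>auto simp: Pi_def\<close>)
    also have "\<dots> = (\<Oplus>\<^bsub>S\<^esub>i\<in>{..<d}. \<Oplus>\<^bsub>S\<^esub>l\<in>{..<d}. \<eta> (A $$ (i, l)) \<otimes>\<^bsub>S\<^esub> \<eta> (B $$ (l, j)) \<otimes>\<^bsub>S\<^esub> v i)"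
      by (rule S.finsum_swap) (use A B j v' in auto)
    also have "\<dots> = (\<Oplus>\<^bsub>S\<^esub>i\<in>{..<d}. \<eta> ((A \<otimes>\<^bsub>matrix_ring k d\<^esub> B) $$ (i, j)) \<otimes>\<^bsub>S\<^esub> v i)"
    proof (rule S.finsum_cong')
      fix i assume "i \<in> {..<d}"
      then have i: "i < d" by simp
      have "\<eta> ((A \<otimes>\<^bsub>matrix_ring k d\<^esub> B) $$ (i, j)) =
          \<eta> (\<Oplus>\<^bsub>k\<^esub>l\<in>{..<d}. A $$ (i, l) \<otimes>\<^bsub>k\<^esub> B $$ (l, j))"
        using i j by (simp add: matrix_ring_def)
      also have "\<dots> = (\<Oplus>\<^bsub>S\<^esub>l\<in>{..<d}. \<eta> (A $$ (i, l) \<otimes>\<^bsub>k\<^esub> B $$ (l, j)))"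
        using A[OF i] B[OF _ j] by (subst \<eta>.hom_finsum) (auto simp: comp_def)
      also have "\<dots> = (\<Oplus>\<^bsub>S\<^esub>l\<in>{..<d}. \<eta> (A $$ (i, l)) \<otimes>\<^bsub>S\<^esub> \<eta> (B $$ (l, j)))"
        by (rule S.finsum_cong') (use A[OF i] B[OF _ j] in auto)
      finally show "(\<Oplus>\<^bsub>S\<^esub>l\<in>{..<d}. \<eta> (A $$ (i, l)) \<otimes>\<^bsub>S\<^esub> \<eta> (B $$ (l, j)) \<otimes>\<^bsub>S\<^esub> v i) =
        \<eta> ((A \<otimes>\<^bsub>matrix_ring k d\<^esub> B) $$ (i, j)) \<otimes>\<^bsub>S\<^esub> v i"
        using A[OF i] B[OF _ j] v'[OF i] by (simp add: S.finsum_ldistr Pi_def)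
    next
      have "A \<otimes>\<^bsub>matrix_ring k d\<^esub> B \<in> ?M"
        using ring_matrix_ring[OF k] repM that by (blast intro: ring.ring_simprules)
      then show "(\<lambda>i. \<eta> ((A \<otimes>\<^bsub>matrix_ring k d\<^esub> B) $$ (i, j)) \<otimes>\<^bsub>S\<^esub> v i) \<in> {..<d} \<rightarrow> carrier S"
        using entry j v' by auto
    qed simp
    finally show "(a \<otimes>\<^bsub>S\<^esub> b) \<otimes>\<^bsub>S\<^esub> v j =
      (\<Oplus>\<^bsub>S\<^esub>i\<in>{..<d}. \<eta> ((A \<otimes>\<^bsub>matrix_ring k d\<^esub> B) $$ (i, j)) \<otimes>\<^bsub>S\<^esub> v i)" .
  qed
  define f where "f = (\<lambda>a. SOME A. rep a A)"
  have f: "rep a (f a)" if "a \<in> carrier S" for a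
    unfolding f_def using rep_ex[OF that] by (rule someI_ex)
  have "f \<in> ring_hom S (matrix_ring k d)"
  proof (rule ring_hom_memI)
    fix a b assume ab: "a \<in> carrier S" "b \<in> carrier S"
    show "f (a \<otimes>\<^bsub>S\<^esub> b) = f a \<otimes>\<^bsub>matrix_ring k d\<^esub> f b"
      using ab f by (blast intro: rep_unique rep_mult)
    show "f (a \<oplus>\<^bsub>S\<^esub> b) = f a \<oplus>\<^bsub>matrix_ring k d\<^esub> f b"
      using ab f by (blast intro: rep_unique rep_add)
  next
    show "f \<one>\<^bsub>S\<^esub> = \<one>\<^bsub>matrix_ring k d\<^esub>"
      using f rep_one by (blast intro: rep_unique)
  qed (use f repM in blast)
  moreover have "inj_on f (carrier S)"
    using f rep_inj by (metis inj_onI)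
  ultimately show ?thesis
    by blast
qed

lemma (in ring) combine_eq_finsum:
  assumes "length Ks = length Us" "set Ks \<subseteq> carrier R" "set Us \<subseteq> carrier R"
  shows "combine Ks Us = (\<Oplus>i\<in>{..<length Us}. Ks ! i \<otimes> Us ! i)"
  using assms
proof (induction Ks Us rule: list_induct2)
  case (Cons x xs y ys)
  have "(\<Oplus>i\<in>{..<Suc (length ys)}. (x # xs) ! i \<otimes> (y # ys) ! i) =
      (\<Oplus>i\<in>insert 0 (Suc ` {..<length ys}). (x # xs) ! i \<otimes> (y # ys) ! i)"
    by (simp add: lessThan_Suc_eq_insert_0)
  also have "\<dots> = x \<otimes> y \<oplus> (\<Oplus>i\<in>Suc ` {..<length ys}. (x # xs) ! i \<otimes> (y # ys) ! i)"
    using Cons by (subst finsum_insert) (auto simp: subset_iff)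
  also have "(\<Oplus>i\<in>Suc ` {..<length ys}. (x # xs) ! i \<otimes> (y # ys) ! i) =
      (\<Oplus>i\<in>{..<length ys}. xs ! i \<otimes> ys ! i)"
    using Cons by (subst finsum_reindex) (auto simp: subset_iff)
  finally show ?case
    using Cons by simp
qed simp

text \<open>
  The list of all elements of \<open>S\<close> spans \<open>S\<close> over its prime field, so it contains a basis. Coordinates
  are then transported from the prime field to the residue ring along the canonical isomorphism.
\<close>
lemma finite_field_embeds_into_matrix_ring:
  assumes S: "field S" and fin: "finite (carrier S)" and char: "characteristic S > 0"
  shows "\<exists>d\<ge>1. \<exists>f\<in>ring_hom S (matrix_ring (residue_ring (int (characteristic S))) d).
    inj_on f (carrier S)"
proof -
  interpret S: field S by fact
  define k where "k = residue_ring (int (characteristic S))"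
  define \<eta> where "\<eta> = (\<lambda>i. [(nat i)] \<cdot>\<^bsub>S\<^esub> \<one>\<^bsub>S\<^esub>)"
  have p: "Factorial_Ring.prime (characteristic S)"
    using S.prime_characteristic[OF char] .
  interpret k: residues_prime "characteristic S" k
    unfolding k_def by unfold_locales (rule p)
  have \<eta>: "\<eta> \<in> ring_hom k S"
    unfolding \<eta>_def k_def by (rule residue_ring_hom[OF S.ring_axioms prime_gt_1_nat[OF p]])
  have \<eta>_inj: "inj_on \<eta> (carrier k)"
    unfolding \<eta>_def k_def by (rule residue_ring_hom_inj[OF S.ring_axioms char])
  interpret \<eta>: ring_hom_ring k S \<eta>
    using k.ring_axioms S.ring_axioms \<eta> by (rule ring_hom_ringI2)
  define K where "K = \<eta> ` carrier k"
  have K: "subfield K S"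
    unfolding K_def using \<eta>.img_is_subfield(2)[OF k.carrier_is_subfield] by simp
  obtain Us where Us: "set Us = carrier S"
    using finite_list[OF fin] by blast
  obtain Vs where Vs: "set Vs \<subseteq> carrier S" "S.independent K Vs" "S.Span K Vs = S.Span K Us"
    using S.filter_base[OF K, of Us] Us by auto
  have Span: "S.Span K Vs = carrier S"
    using S.Span_base_incl[OF K, of Us] S.Span_in_carrier[of K Us] subfieldE(3)[OF K] Us Vs by auto
  define d where "d = length Vs"
  define v where "v = (\<lambda>i. Vs ! i)"
  have v: "v \<in> {..<d} \<rightarrow> carrier S"
    using Vs(1) by (auto simp: v_def d_def)
  have lift: "(\<Oplus>\<^bsub>S\<^esub>i\<in>{..<d}. \<eta> (c i) \<otimes>\<^bsub>S\<^esub> v i) = S.combine (map (\<lambda>i. \<eta> (c i)) [0..<d]) Vs"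
    and lift_K: "set (map (\<lambda>i. \<eta> (c i)) [0..<d]) \<subseteq> K"
    if c: "c \<in> {..<d} \<rightarrow> carrier k" for c
  proof -
    show K': "set (map (\<lambda>i. \<eta> (c i)) [0..<d]) \<subseteq> K"
      using c by (auto simp: K_def)
    have "S.combine (map (\<lambda>i. \<eta> (c i)) [0..<d]) Vs =
      (\<Oplus>\<^bsub>S\<^esub>i\<in>{..<d}. map (\<lambda>i. \<eta> (c i)) [0..<d] ! i \<otimes>\<^bsub>S\<^esub> Vs ! i)"
      unfolding d_def
      by (rule S.combine_eq_finsum) (use K' Vs(1) subfieldE(3)[OF K] in \<open>auto simp: d_def\<close>)
    also have "\<dots> = (\<Oplus>\<^bsub>S\<^esub>i\<in>{..<d}. \<eta> (c i) \<otimes>\<^bsub>S\<^esub> v i)"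
      by (rule S.finsum_cong') (use c v in \<open>auto simp: v_def Pi_def\<close>)
    finally show "(\<Oplus>\<^bsub>S\<^esub>i\<in>{..<d}. \<eta> (c i) \<otimes>\<^bsub>S\<^esub> v i) = S.combine (map (\<lambda>i. \<eta> (c i)) [0..<d]) Vs" ..
  qed
  have "\<exists>f\<in>ring_hom S (matrix_ring k d). inj_on f (carrier S)"
  proof (rule regular_representation[OF k.ring_axioms S.is_cring \<eta> v])
    fix s assume "s \<in> carrier S"
    then obtain Ks where Ks: "set Ks \<subseteq> K" "length Ks = d" "s = S.combine Ks Vs"
      using S.Span_mem_iff_length_version[OF K Vs(1), of s] Span by (auto simp: d_def)
    define c where "c = (\<lambda>i. inv_into (carrier k) \<eta> (Ks ! i))"
    have c: "c i \<in> carrier k" "\<eta> (c i) = Ks ! i" if "i < d" for i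
      using that Ks by (auto simp: c_def K_def subset_iff inv_into_into f_inv_into_f)
    have "map (\<lambda>i. \<eta> (c i)) [0..<d] = Ks"
      using c Ks by (intro nth_equalityI) auto
    then show "\<exists>c\<in>{..<d} \<rightarrow> carrier k. s = (\<Oplus>\<^bsub>S\<^esub>i\<in>{..<d}. \<eta> (c i) \<otimes>\<^bsub>S\<^esub> v i)"
      using lift[of c] c Ks(3) by (intro bexI[of _ c]) auto
  next
    fix c c' assume cc: "c \<in> {..<d} \<rightarrow> carrier k" "c' \<in> {..<d} \<rightarrow> carrier k"
      and eq: "(\<Oplus>\<^bsub>S\<^esub>i\<in>{..<d}. \<eta> (c i) \<otimes>\<^bsub>S\<^esub> v i) = (\<Oplus>\<^bsub>S\<^esub>i\<in>{..<d}. \<eta> (c' i) \<otimes>\<^bsub>S\<^esub> v i)"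
    have in_Span: "S.combine (map (\<lambda>i. \<eta> (c i)) [0..<d]) Vs \<in> S.Span K Vs"
      unfolding S.Span_mem_iff_length_version[OF K Vs(1)] using lift_K[OF cc(1)]
      by (intro exI[of _ "map (\<lambda>i. \<eta> (c i)) [0..<d]"]) (auto simp: d_def)
    have "map (\<lambda>i. \<eta> (c i)) [0..<d] = map (\<lambda>i. \<eta> (c' i)) [0..<d]"
      using S.unique_decomposition[OF K Vs(2) in_Span] lift_K[OF cc(1)] lift_K[OF cc(2)]
        lift[OF cc(1)] lift[OF cc(2)] eq
      by (metis d_def diff_zero length_map length_upt)
    then show "\<forall>i<d. c i = c' i"
      using cc \<eta>_inj by (auto simp: inj_on_def Pi_def)
  qed
  moreover have "d \<ge> 1"
  proof (rule ccontr)
    assume "\<not> d \<ge> 1"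
    then have "Vs = []"
      by (cases Vs) (auto simp: d_def)
    then have "carrier S = {\<zero>\<^bsub>S\<^esub>}"
      using Span by simp
    then show False
      using S.one_not_zero S.one_closed by blast
  qed
  ultimately show ?thesis
    unfolding k_def by blast
qed

theorem proposition1p7:
  fixes F :: "('a, 'm) ring_scheme" and p :: nat
  assumes "field F" and "characteristic F = p" and "p > 0"
  shows "locally_embeddable F (finite_fields p) \<and>
         locally_embeddable F {matrix_ring (residue_ring (int p)) d | d. d \<ge> 1}"
proof
  show fin: "locally_embeddable F (finite_fields p)"
    using locally_embeddable_finite_fields assms by blast
  show "locally_embeddable F {matrix_ring (residue_ring (int p)) d | d. d \<ge> 1}"
  proof (rule locally_embeddable_inj_homs[OF fin])
    fix S assume "S \<in> finite_fields p"
    then show "\<exists>T\<in>{matrix_ring (residue_ring (int p)) d | d. d \<ge> 1}.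
        \<exists>h\<in>ring_hom S T. inj_on h (carrier S)"
      using finite_field_embeds_into_matrix_ring[of S] assms(3) unfolding finite_fields_def by blast
  qed
qed

end
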